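(* For every constant $c>0$ there is a constant $C>0$ depending only on $c$ (in particular not on $d,f,\alpha,\beta,\mathbf{X}^*,t$) such that the following holds. Let $0<\alpha\le\beta$, let $f:\mathbb{S}_d\to\mathbb{R}$ be $\alpha$-strongly convex and $\beta$-smooth with respect to $\Vert\cdot\Vert_F$, and let $\mathbf{X}^*$ be the unique minimizer of $f$ over the spectrahedron $\mathcal{S}_d$. For $t\ge 1$ put $$B_t:=\min\left\{\frac{\beta}{t},\ \left(\frac{\beta\sqrt{\mathrm{rank}(\mathbf{X}^* )}}{\alpha^{1/4}\,t}\right)^{4/3},\ \left(\frac{\beta}{\sqrt{\alpha}\,\lambda_{\min}(\mathbf{X}^* )\,t}\right)^{2}\right\}.$$ Run the Randomized Rank one-regularized Conditional Gradient algorithm (described in the context) with step-sizes $\eta_t=18/(t+8)$ for $t\ge1$ and error tolerances $\xi_0=\beta$ and $0<\xi_t\le c\,B_t$ for all $t\ge 1$. Then all iterates are feasible, i.e. $\mathbf{X}_t\in\mathcal{S}_d$ for all $t\ge1$, and $$\forall t\ge 1:\quad \mathbb{E}\left[f(\mathbf{X}_t)-f(\mathbf{X}^* )\right]\le C\,B_t .$$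
   Context: $\mathbb{S}_d$ is the space of real symmetric $d\times d$ matrices, with inner product $\mathbf{A}\bullet\mathbf{B}=\mathrm{Tr}(\mathbf{A}\mathbf{B})$ and Frobenius norm $\Vert\cdot\Vert_F$; the spectrahedron is $\mathcal{S}_d=\{\mathbf{X}\in\mathbb{S}_d : \mathbf{X}\succeq 0,\ \mathrm{Tr}(\mathbf{X})=1\}$. For $\mathbf{X}\in\mathcal{S}_d$, $\lambda_{\min}(\mathbf{X})$ denotes the smallest non-zero eigenvalue of $\mathbf{X}$. A differentiable $f:\mathbb{S}_d\to\mathbb{R}$ (gradient $\nabla f(\mathbf{X})\in\mathbb{S}_d$ taken with respect to $\bullet$) is $\alpha$-strongly convex w.r.t. $\Vert\cdot\Vert_F$ if $f(\mathbf{Y})\ge f(\mathbf{X})+(\mathbf{Y}-\mathbf{X})\bullet\nabla f(\mathbf{X})+\frac{\alpha}{2}\Vert\mathbf{X}-\mathbf{Y}\Vert_F^2$ for all $\mathbf{X},\mathbf{Y}$, and $\beta$-smooth w.r.t. $\Vert\cdot\Vert_F$ if $f(\mathbf{Y})\le f(\mathbf{X})+(\mathbf{Y}-\mathbf{X})\bullet\nabla f(\mathbf{X})+\frac{\beta}{2}\Vert\mathbf{X}-\mathbf{Y}\Vert_F^2$ for all $\mathbf{X},\mathbf{Y}$. For $\mathbf{A}\in\mathbb{S}_d$ and $\xi>0$, $\mathrm{EV}_\xi(\mathbf{A})$ denotes a (any) unit vector $\mathbf{v}$ with $\mathbf{v}^\top\mathbf{A}\mathbf{v}\ge\lambda_{\max}(\mathbf{A})-\xi$.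 Algorithm (Randomized Rank one-regularized Conditional Gradient). Input: step-sizes $\{\eta_t\}_{t\ge1}$, tolerances $\{\xi_t\}_{t\ge0}$. Let $\mathbf{x}_0$ be an arbitrary unit vector, $\mathbf{x}_1\leftarrow\mathrm{EV}_{\xi_0}(-\nabla f(\mathbf{x}_0\mathbf{x}_0^\top))$, $\mathbf{X}_1\leftarrow\mathbf{x}_1\mathbf{x}_1^\top$ (with decomposition consisting of one component of weight $1$). For $t=1,2,\dots$: the current iterate comes with an explicit decomposition $\mathbf{X}_t=\sum_{i=1}^k a_i\mathbf{x}_i\mathbf{x}_i^\top$ with unit vectors $\mathbf{x}_i$ and $(a_1,\dots,a_k)$ a probability distribution over $[k]=\{1,\dots,k\}$; pick $i_t\in[k]$ at random with (conditional on the past) distribution $(a_1,\dots,a_k)$; set $\tilde\eta_t=\eta_t/2$ if $a_{i_t}\ge\eta_t$ and $\tilde\eta_t=a_{i_t}$ otherwise; set $\mathbf{v}_t\leftarrow\mathrm{EV}_{\xi_t}(-\nabla f(\mathbf{X}_t)+\eta_t\beta\,\mathbf{x}_{i_t}\mathbf{x}_{i_t}^\top)$ and $\mathbf{X}_{t+1}\leftarrow\mathbf{X}_t+\tilde\eta_t(\mathbf{v}_t\mathbf{v}_t^\top-\mathbf{x}_{i_t}\mathbf{x}_{i_t}^\top)$. The decomposition of $\mathbf{X}_{t+1}$ is obtained from that of $\mathbf{X}_t$ by moving mass $\tilde\eta_t$ from component $i_t$ (which is dropped if its remaining weight is $0$) to a new component $\mathbf{v}_t\mathbf{v}_t^\top$,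 all other weights unchanged. Expectation is over the random choices of the algorithm. *)

theory Defs
  imports
    "HOL-Probability.Probability_Mass_Function"
    "Jordan_Normal_Form.DL_Rank"
    "Jordan_Normal_Form.Spectral_Radius"
begin

no_notation inner (infix "\<bullet>" 70)

text \<open>
  Matrices come from the carrier-based library, because the dimension \<open>d\<close> has to be quantified
  below the absolute constant, which is impossible if \<open>d\<close> is encoded in a type.
\<close>

definition sym_mats :: "nat \<Rightarrow> real mat set" where
  "sym_mats d = {A \<in> carrier_mat d d. transpose_mat A = A}"

definition tr :: "real mat \<Rightarrow> real" where
  "tr A = (\<Sum>i<dim_row A. A $$ (i, i))"

definition mat_inner :: "real mat \<Rightarrow> real mat \<Rightarrow> real" where
  "mat_inner A B = tr (A * B)"

definition fro_norm :: "real mat \<Rightarrow> real" where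
  "fro_norm A = sqrt (\<Sum>i<dim_row A. \<Sum>j<dim_col A. (A $$ (i, j))\<^sup>2)"

definition psd :: "nat \<Rightarrow> real mat \<Rightarrow> bool" where
  "psd d A \<longleftrightarrow> A \<in> sym_mats d \<and> (\<forall>v \<in> carrier_vec d. 0 \<le> v \<bullet> (A *\<^sub>v v))"

definition spectrahedron :: "nat \<Rightarrow> real mat set" where
  "spectrahedron d = {X \<in> sym_mats d. psd d X \<and> tr X = 1}"

definition eig_max :: "real mat \<Rightarrow> real" where
  "eig_max A = Max (spectrum A)"

definition eig_min_nonzero :: "real mat \<Rightarrow> real" where
  "eig_min_nonzero A = Min (spectrum A - {0})"

definition unit_vecs :: "nat \<Rightarrow> real vec set" where
  "unit_vecs d = {v \<in> carrier_vec d. sqrt (v \<bullet> v) = 1}"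

definition outer :: "real vec \<Rightarrow> real mat" where
  "outer v = mat (dim_vec v) (dim_vec v) (\<lambda>(i, j). v $ i * v $ j)"

text \<open>Frechet differentiability inside the space of symmetric matrices.\<close>

definition has_gradient :: "nat \<Rightarrow> (real mat \<Rightarrow> real) \<Rightarrow> real mat \<Rightarrow> real mat \<Rightarrow> bool" where
  "has_gradient d f G X \<longleftrightarrow> G \<in> sym_mats d \<and>
     (\<forall>\<epsilon>>0. \<exists>\<delta>>0. \<forall>H \<in> sym_mats d. fro_norm H < \<delta> \<longrightarrow>
        \<bar>f (X + H) - f X - mat_inner H G\<bar> \<le> \<epsilon> * fro_norm H)"

definition is_gradient :: "nat \<Rightarrow> (real mat \<Rightarrow> real) \<Rightarrow> (real mat \<Rightarrow> real mat) \<Rightarrow> bool" where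
  "is_gradient d f g \<longleftrightarrow> (\<forall>X \<in> sym_mats d. has_gradient d f (g X) X)"

definition strongly_convex ::
    "nat \<Rightarrow> real \<Rightarrow> (real mat \<Rightarrow> real) \<Rightarrow> (real mat \<Rightarrow> real mat) \<Rightarrow> bool" where
  "strongly_convex d \<alpha> f g \<longleftrightarrow> (\<forall>X \<in> sym_mats d. \<forall>Y \<in> sym_mats d.
     f Y \<ge> f X + mat_inner (Y - X) (g X) + \<alpha> / 2 * (fro_norm (X - Y))\<^sup>2)"

definition smooth ::
    "nat \<Rightarrow> real \<Rightarrow> (real mat \<Rightarrow> real) \<Rightarrow> (real mat \<Rightarrow> real mat) \<Rightarrow> bool" where
  "smooth d \<beta> f g \<longleftrightarrow> (\<forall>X \<in> sym_mats d. \<forall>Y \<in> sym_mats d.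
     f Y \<le> f X + mat_inner (Y - X) (g X) + \<beta> / 2 * (fro_norm (X - Y))\<^sup>2)"

definition approx_EV :: "nat \<Rightarrow> real \<Rightarrow> real mat \<Rightarrow> real vec set" where
  "approx_EV d \<xi> A = {v \<in> unit_vecs d. v \<bullet> (A *\<^sub>v v) \<ge> eig_max A - \<xi>}"


text \<open>
  A decomposition is a list of pairs of a weight and a vector. Components are indexed from 0.
\<close>

type_synonym decomposition = "(real \<times> real vec) list"

definition mat_of_decomp :: "nat \<Rightarrow> decomposition \<Rightarrow> real mat" where
  "mat_of_decomp d D = foldr (\<lambda>(a, x) M. a \<cdot>\<^sub>m outer x + M) D (0\<^sub>m d d)"

definition step_mass :: "real \<Rightarrow> real \<Rightarrow> real" where
  "step_mass \<eta> a = (if a \<ge> \<eta> then \<eta> / 2 else a)"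

definition move_mass :: "real \<Rightarrow> nat \<Rightarrow> real vec \<Rightarrow> decomposition \<Rightarrow> decomposition" where
  "move_mass m i v D =
     (if fst (D ! i) - m = 0 then take i D @ drop (Suc i) D
      else D[i := (fst (D ! i) - m, snd (D ! i))]) @ [(m, v)]"

definition index_pmf :: "decomposition \<Rightarrow> nat pmf" where
  "index_pmf D = pmf_of_list (zip [0..<length D] (map fst D))"

text \<open>
  A history is the list of the sampled indices, most recent first, so that \<open>X\<^sub>t\<close> belongs to a
  history \<open>[i\<^bsub>t-1\<^esub>, \<dots>, i\<^sub>1]\<close> of length \<open>t - 1\<close>. The answers of the eigenvector oracle are resolved by
  a function \<open>ev\<close> of the history: \<open>ev []\<close> is \<open>x\<^sub>1\<close>, and \<open>ev [i\<^sub>t, \<dots>, i\<^sub>1]\<close> is \<open>v\<^sub>t\<close>. Thus the oracle is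
  an arbitrary one, which may give different answers to the same query at different times.
\<close>

type_synonym history = "nat list"

fun decomp :: "(nat \<Rightarrow> real) \<Rightarrow> (history \<Rightarrow> real vec) \<Rightarrow> history \<Rightarrow> decomposition" where
  "decomp \<eta> ev [] = [(1, ev [])]"
| "decomp \<eta> ev (i # h) =
     (let D = decomp \<eta> ev h; t = length h + 1
      in move_mass (step_mass (\<eta> t) (fst (D ! i))) i (ev (i # h)) D)"

definition iterate :: "nat \<Rightarrow> (nat \<Rightarrow> real) \<Rightarrow> (history \<Rightarrow> real vec) \<Rightarrow> history \<Rightarrow> real mat" where
  "iterate d \<eta> ev h = mat_of_decomp d (decomp \<eta> ev h)"

primrec draws :: "(nat \<Rightarrow> real) \<Rightarrow> (history \<Rightarrow> real vec) \<Rightarrow> nat \<Rightarrow> history pmf" where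
  "draws \<eta> ev 0 = return_pmf []"
| "draws \<eta> ev (Suc n) =
     bind_pmf (draws \<eta> ev n) (\<lambda>h. map_pmf (\<lambda>i. i # h) (index_pmf (decomp \<eta> ev h)))"

text \<open>The law of the indices sampled before round \<open>t\<close>, for \<open>t \<ge> 1\<close>.\<close>

definition past :: "(nat \<Rightarrow> real) \<Rightarrow> (history \<Rightarrow> real vec) \<Rightarrow> nat \<Rightarrow> history pmf" where
  "past \<eta> ev t = draws \<eta> ev (t - 1)"

text \<open>
  The oracle answers are correct for the run of the algorithm started at \<open>x\<^sub>0\<close>; nothing is required
  for histories that occur with probability 0.
\<close>

definition RRCG_run ::
    "nat \<Rightarrow> (real mat \<Rightarrow> real mat) \<Rightarrow> real \<Rightarrow> (nat \<Rightarrow> real) \<Rightarrow> (nat \<Rightarrow> real) \<Rightarrow> real vec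
      \<Rightarrow> (history \<Rightarrow> real vec) \<Rightarrow> bool" where
  "RRCG_run d g \<beta> \<eta> \<xi> x\<^sub>0 ev \<longleftrightarrow>
     x\<^sub>0 \<in> unit_vecs d \<and>
     ev [] \<in> approx_EV d (\<xi> 0) (- g (outer x\<^sub>0)) \<and>
     (\<forall>t\<ge>1. \<forall>h \<in> set_pmf (past \<eta> ev t). \<forall>i \<in> set_pmf (index_pmf (decomp \<eta> ev h)).
        ev (i # h) \<in> approx_EV d (\<xi> t)
          (- g (iterate d \<eta> ev h) + (\<eta> t * \<beta>) \<cdot>\<^sub>m outer (snd (decomp \<eta> ev h ! i))))"

definition rate_bound :: "nat \<Rightarrow> real \<Rightarrow> real \<Rightarrow> real mat \<Rightarrow> nat \<Rightarrow> real" where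
  "rate_bound d \<alpha> \<beta> X t =
     Min {\<beta> / real t,
          (\<beta> * sqrt (real (vec_space.rank d X)) / (\<alpha> powr (1/4) * real t)) powr (4/3),
          (\<beta> / (sqrt \<alpha> * eig_min_nonzero X * real t))\<^sup>2}"


text \<open>
  Two consistency facts: the matrices of the decompositions obey the update rule of the algorithm,
  and the weights always form a distribution, so that \<^const>\<open>index_pmf\<close> is applied to
  well-formed lists only.
\<close>

lemma outer_carrier [simp]: "x \<in> carrier_vec d \<Longrightarrow> outer x \<in> carrier_mat d d"
  by (auto simp: outer_def)

lemma mat_of_decomp_carrier [simp]:
  "snd ` set D \<subseteq> carrier_vec d \<Longrightarrow> mat_of_decomp d D \<in> carrier_mat d d"
  unfolding mat_of_decomp_def by (induction D) auto

lemma mat_of_decomp_index: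
  assumes "snd ` set D \<subseteq> carrier_vec d" "p < d" "q < d"
  shows "mat_of_decomp d D $$ (p, q) = (\<Sum>(a, x)\<leftarrow>D. a * outer x $$ (p, q))"
  using assms
proof (induction D)
  case Nil
  then show ?case by (simp add: mat_of_decomp_def)
next
  case (Cons b D)
  obtain a x where b: "b = (a, x)" by fastforce
  have x: "x \<in> carrier_vec d" and D: "snd ` set D \<subseteq> carrier_vec d"
    using Cons.prems b by auto
  have "mat_of_decomp d (b # D) = a \<cdot>\<^sub>m outer x + mat_of_decomp d D"
    by (simp add: mat_of_decomp_def b)
  then show ?case
    using Cons.IH[OF D Cons.prems(2,3)] Cons.prems(2,3) outer_carrier[OF x]
      mat_of_decomp_carrier[OF D] by (simp add: b)
qed

lemma sum_list_move_mass:
  fixes F :: "real vec \<Rightarrow> real"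
  assumes "i < length D"
  shows "(\<Sum>(a, x)\<leftarrow>move_mass m i v D. a * F x) =
         (\<Sum>(a, x)\<leftarrow>D. a * F x) + m * (F v - F (snd (D ! i)))"
proof -
  have D: "D = take i D @ (fst (D ! i), snd (D ! i)) # drop (Suc i) D"
    using id_take_nth_drop[OF assms] by simp
  have upd: "D[i := y] = take i D @ y # drop (Suc i) D" for y
    using upd_conv_take_nth_drop[OF assms] by simp
  have "(\<Sum>(a, x)\<leftarrow>D. a * F x) = (\<Sum>(a, x)\<leftarrow>take i D. a * F x)
      + fst (D ! i) * F (snd (D ! i)) + (\<Sum>(a, x)\<leftarrow>drop (Suc i) D. a * F x)"
    by (subst D) (simp del: prod.collapse)
  then show ?thesis
    by (auto simp: move_mass_def upd algebra_simps)
qed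

lemma set_move_mass: "set (move_mass m i v D) \<subseteq> 
    insert (m, v) (insert (fst (D ! i) - m, snd (D ! i)) (set D))"
  using set_take_subset[of i D] set_drop_subset[of "Suc i" D]
    set_update_subset_insert[of D i "(fst (D ! i) - m, snd (D ! i))"]
  unfolding move_mass_def by (cases "fst (D ! i) - m = 0") (auto simp del: prod.collapse)

lemma mat_of_decomp_move_mass:
  assumes D: "snd ` set D \<subseteq> carrier_vec d" and v: "v \<in> carrier_vec d" and i: "i < length D"
  shows "mat_of_decomp d (move_mass m i v D) =
         mat_of_decomp d D + m \<cdot>\<^sub>m (outer v - outer (snd (D ! i)))"
proof -
  have x: "snd (D ! i) \<in> carrier_vec d" using D i by (auto simp: subset_iff)
  have D': "snd ` set (move_mass m i v D) \<subseteq> carrier_vec d"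
    using set_move_mass[of m i v D] D v x by fastforce
  show ?thesis
  proof (rule eq_matI)
    fix p q
    assume "p < dim_row (mat_of_decomp d D + m \<cdot>\<^sub>m (outer v - outer (snd (D ! i))))"
      and "q < dim_col (mat_of_decomp d D + m \<cdot>\<^sub>m (outer v - outer (snd (D ! i))))"
    then have pq: "p < d" "q < d" using outer_carrier[OF x] by auto
    show "mat_of_decomp d (move_mass m i v D) $$ (p, q) =
        (mat_of_decomp d D + m \<cdot>\<^sub>m (outer v - outer (snd (D ! i)))) $$ (p, q)"
      using pq outer_carrier[OF x] outer_carrier[OF v] mat_of_decomp_carrier[OF D]
      by (simp add: mat_of_decomp_index[OF D' pq] mat_of_decomp_index[OF D pq]
          sum_list_move_mass[OF i, where F = "\<lambda>x. outer x $$ (p, q)"])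
  qed (use outer_carrier[OF x] mat_of_decomp_carrier[OF D'] in auto)
qed

lemma decomp_weights:
  assumes "\<And>t. \<eta> t > 0" "h \<in> set_pmf (draws \<eta> ev n)"
  shows "length h = n \<and> (\<forall>p \<in> set (decomp \<eta> ev h). fst p > 0) \<and>
         (\<Sum>(a, x)\<leftarrow>decomp \<eta> ev h. a) = 1 \<and>
         pmf_of_list_wf (zip [0..<length (decomp \<eta> ev h)] (map fst (decomp \<eta> ev h)))"
proof -
  have wf: "pmf_of_list_wf (zip [0..<length D] (map fst D))"
    if "\<forall>p \<in> set D. fst p > 0" "(\<Sum>(a, x)\<leftarrow>D. a) = 1" for D :: decomposition
    using that by (auto simp: pmf_of_list_wf_def dest!: set_zip_rightD intro: less_imp_le
        simp: case_prod_unfold)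
  have "length h = n \<and> (\<forall>p \<in> set (decomp \<eta> ev h). fst p > 0) \<and> (\<Sum>(a, x)\<leftarrow>decomp \<eta> ev h. a) = 1"
    using assms(2)
  proof (induction n arbitrary: h)
    case 0
    then show ?case by simp
  next
    case (Suc n)
    then obtain i g where h: "h = i # g" and g: "g \<in> set_pmf (draws \<eta> ev n)"
      and i: "i \<in> set_pmf (index_pmf (decomp \<eta> ev g))" by auto
    let ?D = "decomp \<eta> ev g"
    let ?m = "step_mass (\<eta> (length g + 1)) (fst (?D ! i))"
    note IH = Suc.IH[OF g]
    have iD: "i < length ?D"
      using i set_pmf_of_list[OF wf, of ?D] IH
      by (auto simp: index_pmf_def dest!: set_zip_leftD)
    have a: "fst (?D ! i) > 0" using IH iD by simp
    have m: "?m > 0" "fst (?D ! i) - ?m \<ge> 0"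
      using a assms(1)[of "length g + 1"] by (auto simp: step_mass_def)
    have "(\<Sum>(a, x)\<leftarrow>move_mass ?m i (ev (i # g)) ?D. a) = 1"
      using sum_list_move_mass[OF iD, where F = "\<lambda>_. 1"] IH by simp
    moreover have "fst p > 0" if "p \<in> set (move_mass ?m i (ev (i # g)) ?D)" for p
    proof (cases "fst (?D ! i) - ?m = 0")
      case True
      then have "p \<in> insert (?m, ev (i # g)) (set ?D)"
        using that set_take_subset[of i ?D] set_drop_subset[of "Suc i" ?D]
        by (auto simp: move_mass_def)
      then show ?thesis using IH m by auto
    next
      case False
      then show ?thesis using subsetD[OF set_move_mass that] IH m by auto
    qed
    ultimately show ?case using h IH by (auto simp: Let_def)
  qed
  then show ?thesis using wf by blast
qed

end

theory Submission
  imports Defs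
begin

text \<open>
  Write \<open>Y\<close> for the minimizer and \<open>X = \<Sum> a\<^sub>i x\<^sub>i x\<^sub>i\<^sup>T\<close> for the current iterate. If \<open>Y = \<Sum> a\<^sub>i W\<^sub>i\<close> with all
  \<open>W\<^sub>i\<close> in the spectrahedron, then smoothness, the choice of \<open>v\<^sub>t\<close> (compared with \<open>W\<^sub>i\<close> when \<open>i\<close> is drawn)
  and convexity give, for the expected error \<open>e\<^sub>t\<close>,
  \<open>e\<^bsub>t+1\<^esub> \<le> (1 - \<eta>\<^sub>t/2) e\<^sub>t + \<eta>\<^sub>t\<^sup>2 \<beta>/2 \<delta> + \<eta>\<^sub>t \<xi>\<^sub>t\<close>, where \<open>\<delta>\<close> is the expectation of \<open>\<Sum> a\<^sub>i (1 - x\<^sub>i\<^sup>T W\<^sub>i x\<^sub>i)\<close>.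

  The choice \<open>W\<^sub>i = Y\<close> gives \<open>\<delta> \<le> 1\<close>. For a better one let \<open>P\<close> be a spectral projection of \<open>Y\<close> onto
  eigenvalues \<open>\<ge> \<tau>\<close> and \<open>\<Delta>\<close> a bound on the Frobenius norm of \<open>X - Y\<close>. Then \<open>PXP \<preceq> (1 + \<Delta>/\<tau>) Y\<close>, so with
  \<open>\<gamma> = 1/(1 + \<Delta>/\<tau>)\<close> the remainder \<open>R = Y - \<gamma> PXP\<close> is positive semidefinite, and \<open>W\<^sub>i\<close> is \<open>\<gamma> (Px\<^sub>i)(Px\<^sub>i)\<^sup>T\<close>
  completed to trace one by a multiple of \<open>R\<close>. This yields \<open>\<delta> \<le> \<Delta>/\<tau> + 2 (1 - tr (PX))\<close>. The smallest nonzero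
  eigenvalue as \<open>\<tau>\<close> gives \<open>3\<Delta>/\<tau>\<close>, and optimizing \<open>\<tau>\<close> gives the order of \<open>sqrt (rank Y * \<Delta>)\<close>. Strong
  convexity bounds \<open>\<Delta>\<close> by the square root of the error, and each of the three bounds on \<open>\<delta>\<close> turns the
  recursion into one of the three rates. Square roots of the error are bounded by affine functions of
  it (AM-GM), so that expectations can be taken.
\<close>

no_notation Finite_Cartesian_Product.vec_nth (infixl "$" 90)

subsection \<open>Orthonormal eigenvectors\<close>

text \<open>For small \<open>t\<close> the linear term dominates, so its coefficient must vanish.
  This yields the stationarity condition at a maximizer of the Rayleigh quotient.\<close>

lemma zero_of_quadratic_nonneg:
  fixes B q :: real
  assumes "\<And>t. 0 \<le> 2 * t * B + t\<^sup>2 * q"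
  shows "B = 0"
proof (rule ccontr)
  assume B: "B \<noteq> 0"
  \<comment> \<open>Since \<open>s * q \<le> 1\<close>, the test point \<open>- s * B\<close> gives
    a value of at most \<open>- s * B\<^sup>2\<close>.\<close>
  define s where "s = 1 / (\<bar>q\<bar> + 1)"
  have s: "s > 0" by (simp add: s_def add_nonneg_pos)
  have "s * q \<le> 1"
    unfolding s_def using abs_ge_self[of q] by (simp add: divide_le_eq)
  then have "s * q * (s * B\<^sup>2) \<le> 1 * (s * B\<^sup>2)"
    using s by (intro mult_right_mono) auto
  moreover have "0 \<le> 2 * (- s * B) * B + (- s * B)\<^sup>2 * q" by (rule assms)
  ultimately have "s * B\<^sup>2 \<le> 0" by (simp add: power2_eq_square algebra_simps)
  then show False using s B by (simp add: mult_le_0_iff)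
qed

text \<open>The squared lengths of the projections of the standard basis vectors onto the span of
  \<open>u\<close> sum to \<open>k < d\<close>, so some basis vector lies outside the span;
  \<open>x\<close> is what Gram-Schmidt leaves of it.\<close>

lemma orthonormal_extension_vector:
  fixes u :: "nat \<Rightarrow> nat \<Rightarrow> real"
  assumes orth: "\<And>i j. i < k \<Longrightarrow> j < k \<Longrightarrow> (\<Sum>l<d. u i l * u j l) = (if i = j then 1 else 0)"
    and "k < d"
  obtains x where "(\<Sum>l<d. x l * x l) > 0" "\<And>j. j < k \<Longrightarrow> (\<Sum>l<d. u j l * x l) = 0"
proof -
  have "\<exists>i<d. (\<Sum>j<k. u j i * u j i) < 1"
  proof (rule ccontr)
    assume "\<not> ?thesis"
    then have "(\<Sum>i<d. 1) \<le> (\<Sum>i<d. \<Sum>j<k. u j i * u j i)" by (intro sum_mono) auto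
    also have "\<dots> = (\<Sum>j<k. \<Sum>i<d. u j i * u j i)" by (rule sum.swap)
    also have "\<dots> = real k" using orth by simp
    finally show False using \<open>k < d\<close> by simp
  qed
  then obtain i where i: "i < d" "(\<Sum>j<k. u j i * u j i) < 1" by blast
  define x where "x = (\<lambda>l. (if l = i then 1 else 0) - (\<Sum>j<k. u j i * u j l))"
  have "0 < x i * x i" using i by (simp add: x_def)
  also have "\<dots> \<le> (\<Sum>l<d. x l * x l)" using i by (intro member_le_sum) auto
  finally have "(\<Sum>l<d. x l * x l) > 0" .
  moreover have "(\<Sum>l<d. u m l * x l) = 0" if "m < k" for m
  proof -
    have "(\<Sum>l<d. u m l * x l) = (\<Sum>l<d. u m l * (if l = i then 1 else 0))
        - (\<Sum>l<d. \<Sum>j<k. u j i * (u m l * u j l))"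
      unfolding x_def
      by (simp add: right_diff_distrib sum_subtractf sum_distrib_left mult_ac cong: if_cong)
    also have "(\<Sum>l<d. \<Sum>j<k. u j i * (u m l * u j l)) = (\<Sum>j<k. u j i * (\<Sum>l<d. u m l * u j l))"
      by (subst sum.swap) (simp add: sum_distrib_left)
    also have "\<dots> = (\<Sum>j<k. u j i * (if m = j then 1 else 0))"
      using that by (intro sum.cong refl arg_cong[where f="\<lambda>z. _ * z"] orth) auto
    also have "\<dots> = u m i" using that by (simp add: if_distrib[of "\<lambda>z. _ * z"] cong: if_cong)
    also have "(\<Sum>l<d. u m l * (if l = i then 1 else 0)) = u m i"
      using i by (simp add: if_distrib[of "\<lambda>z. _ * z"] cong: if_cong)
    finally show ?thesis by simp
  qed
  ultimately show ?thesis using that by blast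
qed

text \<open>The quadratic form of \<open>A\<close> attains its maximum on the unit sphere of the
  complement by compactness, and the maximizer is an eigenvector because the symmetric
  \<open>A\<close> maps the complement to itself.\<close>

lemma eigenvector_in_orthogonal_complement:
  fixes A :: "nat \<Rightarrow> nat \<Rightarrow> real" and u :: "nat \<Rightarrow> nat \<Rightarrow> real"
  assumes sym: "\<And>i j. i < d \<Longrightarrow> j < d \<Longrightarrow> A i j = A j i"
    and orth: "\<And>i j. i < k \<Longrightarrow> j < k \<Longrightarrow> (\<Sum>l<d. u i l * u j l) = (if i = j then 1 else 0)"
    and eig: "\<And>i j. j < k \<Longrightarrow> i < d \<Longrightarrow> (\<Sum>l<d. A i l * u j l) = \<mu> j * u j i"
    and "k < d"
  obtains x m where "(\<Sum>l<d. x l * x l) = 1" "\<And>j. j < k \<Longrightarrow> (\<Sum>l<d. u j l * x l) = 0"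
    "\<And>i. i < d \<Longrightarrow> (\<Sum>l<d. A i l * x l) = m * x i"
proof -
  define dt where "dt x y = (\<Sum>l<d. x l * y l)" for x y :: "nat \<Rightarrow> real"
  define b where "b x y = (\<Sum>i<d. \<Sum>j<d. x i * A i j * y j)" for x y :: "nat \<Rightarrow> real"
  \<comment> \<open>Coordinates from \<open>d\<close> on are pinned to 0, which makes this box
    compact in the product topology; \<open>dt\<close> and \<open>b\<close> never look at
    them.\<close>
  define S :: "(nat \<Rightarrow> real) set" where "S = PiE UNIV (\<lambda>i. if i < d then {-1..1} else {0})"
  define K where "K = S \<inter> {x. dt x x = 1} \<inter> (\<Inter>j<k. {x. dt (u j) x = 0})"
  have "compactin (product_topology (\<lambda>i. euclidean) UNIV) S"
    unfolding S_def compactin_PiE by auto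
  then have "compact S" by (simp add: euclidean_product_topology)
  moreover have "closed ({x. dt x x = 1} \<inter> (\<Inter>j<k. {x. dt (u j) x = 0}))"
    unfolding dt_def
    by (intro closed_Int closed_INT ballI closed_Collect_eq continuous_intros
        continuous_on_product_coordinates)
  ultimately have compact: "compact K"
    unfolding K_def Int_assoc by (rule compact_Int_closed)
  have scale: "\<exists>z\<in>K. \<forall>i<d. z i = y i / sqrt (dt y y)"
    if y: "dt y y > 0" "\<And>j. j < k \<Longrightarrow> dt (u j) y = 0" for y
  proof -
    define z where "z = (\<lambda>i. if i < d then y i / sqrt (dt y y) else 0)"
    have sq: "dt z z = 1"
    proof -
      have "dt z z = (\<Sum>l<d. y l * y l / dt y y)"
        unfolding dt_def z_def using y(1)
        by (intro sum.cong) (auto simp: dt_def)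
      also have "\<dots> = 1" using y(1) by (simp flip: sum_divide_distrib add: dt_def)
      finally show ?thesis .
    qed
    have "dt (u j) z = dt (u j) y / sqrt (dt y y)" for j
      unfolding dt_def z_def by (simp add: sum_divide_distrib)
    then have "dt (u j) z = 0" if "j < k" for j using y(2)[OF that] by simp
    moreover have "z \<in> S"
    proof -
      have "\<bar>z i\<bar> \<le> 1" if "i < d" for i
      proof -
        have "z i * z i \<le> dt z z" unfolding dt_def using that by (intro member_le_sum) auto
        then have "(z i)\<^sup>2 \<le> 1" using sq by (simp add: power2_eq_square)
        then show ?thesis by (simp add: abs_square_le_1)
      qed
      then have "z i \<in> (if i < d then {-1..1} else {0})" for i
        by (cases "i < d") (simp_all add: abs_le_iff minus_le_iff, simp_all add: z_def)
      then show ?thesis unfolding S_def by auto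
    qed
    ultimately have "z \<in> K" using sq by (auto simp: K_def)
    then show ?thesis by (rule bexI[of _ z, rotated]) (simp add: z_def)
  qed
  have "K \<noteq> {}"
  proof -
    obtain y where "dt y y > 0" "\<And>j. j < k \<Longrightarrow> dt (u j) y = 0"
      unfolding dt_def using orthonormal_extension_vector[of k u d] orth \<open>k < d\<close> by blast
    then show ?thesis using scale by blast
  qed
  moreover have "continuous_on K (\<lambda>x. b x x)"
    unfolding b_def
    by (intro continuous_intros continuous_on_subset[OF continuous_on_product_coordinates] subset_UNIV)
  ultimately obtain x where x: "x \<in> K" "\<And>y. y \<in> K \<Longrightarrow> b y y \<le> b x x"
    using continuous_attains_sup[OF compact] by blast
  define m where "m = b x x"
  have xx: "dt x x = 1" and ux: "\<And>j. j < k \<Longrightarrow> dt (u j) x = 0"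
    using x(1) by (auto simp: K_def)
  have ray: "b y y \<le> m * dt y y" if y: "\<And>j. j < k \<Longrightarrow> dt (u j) y = 0" for y
  proof (cases "dt y y > 0")
    case True
    then obtain z where z: "z \<in> K" "\<And>i. i < d \<Longrightarrow> z i = y i / sqrt (dt y y)"
      using scale y by blast
    have "b z z = b y y / dt y y"
      unfolding b_def sum_divide_distrib using z(2) True
      by (intro sum.cong) (auto)
    then show ?thesis using mult_right_mono[OF x(2)[OF z(1)], of "dt y y"] True by (simp add: m_def)
  next
    case False
    have "dt y y \<ge> 0" unfolding dt_def by (intro sum_nonneg) auto
    then have 0: "dt y y = 0" using False by simp
    then have "\<forall>l\<in>{..<d}. y l * y l = 0"
      unfolding dt_def by (subst (asm) sum_nonneg_eq_0_iff) auto
    then have "b y y = 0" by (simp add: b_def)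
    then show ?thesis using 0 by simp
  qed
  have dt_comm: "dt y z = dt z y" for y z by (simp add: dt_def mult.commute)
  have b_comm: "b y z = b z y" for y z
    unfolding b_def by (subst sum.swap) (intro sum.cong refl, auto simp: sym)
  have dt_lin: "dt w (\<lambda>i. y i + t * z i) = dt w y + t * dt w z" for w y z t
    by (simp add: dt_def algebra_simps sum.distrib sum_distrib_left)
  have b_lin: "b w (\<lambda>i. y i + t * z i) = b w y + t * b w z" for w y z t
    by (simp add: b_def algebra_simps sum.distrib sum_distrib_left)
  \<comment> \<open>The form \<open>m * dt - b\<close> is nonnegative on the complement and vanishes
    at \<open>x\<close>, so its polarization at \<open>x\<close> vanishes as well.\<close>
  have perp: "m * dt x y - b x y = 0" if y: "\<And>j. j < k \<Longrightarrow> dt (u j) y = 0" for y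
  proof (rule zero_of_quadratic_nonneg)
    fix t
    let ?w = "\<lambda>i. x i + t * y i"
    have "b ?w ?w \<le> m * dt ?w ?w" by (rule ray) (simp add: dt_lin ux y)
    moreover have "dt ?w ?w = dt x x + 2 * t * dt x y + t\<^sup>2 * dt y y"
      using dt_comm[of ?w x] dt_comm[of ?w y] dt_comm[of y x]
      by (simp add: dt_lin power2_eq_square algebra_simps)
    moreover have "b ?w ?w = b x x + 2 * t * b x y + t\<^sup>2 * b y y"
      using b_comm[of ?w x] b_comm[of ?w y] b_comm[of y x]
      by (simp add: b_lin power2_eq_square algebra_simps)
    ultimately show "0 \<le> 2 * t * (m * dt x y - b x y) + t\<^sup>2 * (m * dt y y - b y y)"
      using xx by (simp add: m_def algebra_simps)
  qed
  \<comment> \<open>The residual of the eigenvalue equation lies in the complement, and testing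
    \<open>perp\<close> against it produces its own squared length. The factor \<open>- 1\<close>
    fits the shape of \<open>dt_lin\<close>.\<close>
  define y where "y = (\<lambda>i. m * x i + (- 1) * (\<Sum>l<d. A i l * x l))"
  have b_dt: "b w x = dt w (\<lambda>i. \<Sum>l<d. A i l * x l)" for w
    by (simp add: b_def dt_def sum_distrib_left mult_ac)
  have "dt (u j) y = 0" if "j < k" for j
  proof -
    have "dt (u j) (\<lambda>i. \<Sum>l<d. A i l * x l) = b x (u j)" by (simp add: b_comm flip: b_dt)
    also have "\<dots> = (\<Sum>i<d. x i * (\<Sum>l<d. A i l * u j l))"
      by (simp add: b_def sum_distrib_left mult_ac)
    also have "\<dots> = \<mu> j * dt (u j) x"
      using that by (simp add: eig dt_def sum_distrib_left mult_ac)
    finally have "dt (u j) (\<lambda>i. \<Sum>l<d. A i l * x l) = 0" using ux that by simp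
    moreover have "dt (u j) (\<lambda>i. m * x i) = m * dt (u j) x"
      by (simp add: dt_def sum_distrib_left mult_ac)
    ultimately show ?thesis unfolding y_def dt_lin using ux that by simp
  qed
  then have "m * dt x y - b x y = 0" by (rule perp)
  moreover have "dt y y = m * dt x y - b x y"
  proof -
    have "dt y y = dt y (\<lambda>i. m * x i) - dt y (\<lambda>i. \<Sum>l<d. A i l * x l)"
      using dt_lin[of y "\<lambda>i. m * x i" "- 1" "\<lambda>i. \<Sum>l<d. A i l * x l", folded y_def] by simp
    also have "dt y (\<lambda>i. m * x i) = m * dt x y"
      by (simp add: dt_def sum_distrib_left mult_ac)
    also have "dt y (\<lambda>i. \<Sum>l<d. A i l * x l) = b x y" by (simp add: b_comm flip: b_dt)
    finally show ?thesis .
  qed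
  ultimately have "dt y y = 0" by simp
  then have "\<forall>l\<in>{..<d}. y l * y l = 0"
    unfolding dt_def by (subst (asm) sum_nonneg_eq_0_iff) auto
  then have "(\<Sum>l<d. A i l * x l) = m * x i" if "i < d" for i
    using that by (auto simp: y_def)
  then show ?thesis using that[of x m] xx ux by (simp add: dt_def)
qed

lemma orthonormal_eigenvectors:
  fixes A :: "nat \<Rightarrow> nat \<Rightarrow> real"
  assumes sym: "\<And>i j. i < d \<Longrightarrow> j < d \<Longrightarrow> A i j = A j i" and "k \<le> d"
  shows "\<exists>u \<mu>. (\<forall>i<k. \<forall>j<k. (\<Sum>l<d. u i l * u j l) = (if i = j then 1 else 0)) \<and>
    (\<forall>j<k. \<forall>i<d. (\<Sum>l<d. A i l * u j l) = \<mu> j * u j i)"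
  using \<open>k \<le> d\<close>
proof (induction k)
  case (Suc k)
  then obtain u \<mu> where
    orth: "\<And>i j. i < k \<Longrightarrow> j < k \<Longrightarrow> (\<Sum>l<d. u i l * u j l) = (if i = j then 1 else 0)"
    and eig: "\<And>i j. j < k \<Longrightarrow> i < d \<Longrightarrow> (\<Sum>l<d. A i l * u j l) = \<mu> j * u j i"
    by (metis Suc_leD)
  obtain x m where x: "(\<Sum>l<d. x l * x l) = 1" "\<And>j. j < k \<Longrightarrow> (\<Sum>l<d. u j l * x l) = 0"
    "\<And>i. i < d \<Longrightarrow> (\<Sum>l<d. A i l * x l) = m * x i"
    by (rule eigenvector_in_orthogonal_complement[of d A k u \<mu>])
      (use sym orth eig Suc.prems in auto)
  have x': "(\<Sum>l<d. x l * u j l) = 0" if "j < k" for j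
    using x(2)[OF that] by (simp add: mult.commute)
  have "(\<Sum>l<d. (u(k := x)) i l * (u(k := x)) j l) = (if i = j then 1 else 0)"
    if "i < Suc k" "j < Suc k" for i j
    using that orth[of i j] x x' by (auto simp: less_Suc_eq)
  moreover have "(\<Sum>l<d. A i l * (u(k := x)) j l) = (\<mu>(k := m)) j * (u(k := x)) j i"
    if "j < Suc k" "i < d" for i j
    using that eig x by (auto simp: less_Suc_eq)
  ultimately show ?case
    by (intro exI[of _ "u(k := x)"] exI[of _ "\<mu>(k := m)"]) blast
qed simp

subsection \<open>Trace inner product and spectral theorem\<close>

lemma sym_matsD: "A \<in> sym_mats d \<Longrightarrow> A \<in> carrier_mat d d"
  "A \<in> sym_mats d \<Longrightarrow> i < d \<Longrightarrow> j < d \<Longrightarrow> A $$ (i, j) = A $$ (j, i)"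
  by (auto simp: sym_mats_def) (metis index_transpose_mat(1) carrier_matD)

lemma sym_matsI:
  "A \<in> carrier_mat d d \<Longrightarrow> (\<And>i j. i < d \<Longrightarrow> j < d \<Longrightarrow> A $$ (i, j) = A $$ (j, i)) \<Longrightarrow> A \<in> sym_mats d"
  by (auto simp: sym_mats_def)

lemma scalar_prod_sum: "v \<in> carrier_vec d \<Longrightarrow> w \<in> carrier_vec d \<Longrightarrow> v \<bullet> w = (\<Sum>i<d. v $ i * w $ i)"
  by (simp add: scalar_prod_def atLeast0LessThan)

lemma mult_mat_vec_sum:
  "A \<in> carrier_mat d d \<Longrightarrow> w \<in> carrier_vec d \<Longrightarrow> i < d \<Longrightarrow> (A *\<^sub>v w) $ i = (\<Sum>j<d. A $$ (i, j) * w $ j)"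
  by (simp add: scalar_prod_def atLeast0LessThan)

lemma mat_inner_sum:
  assumes "A \<in> carrier_mat d d" "B \<in> carrier_mat d d"
  shows "mat_inner A B = (\<Sum>i<d. \<Sum>j<d. A $$ (i, j) * B $$ (j, i))"
  using assms by (simp add: mat_inner_def tr_def scalar_prod_def atLeast0LessThan)

lemma mat_inner_comm:
  assumes "A \<in> carrier_mat d d" "B \<in> carrier_mat d d"
  shows "mat_inner A B = mat_inner B A"
  using assms by (simp add: mat_inner_sum) (subst sum.swap, simp add: mult.commute)

lemma mat_inner_add_left:
  assumes "A \<in> carrier_mat d d" "B \<in> carrier_mat d d" "C \<in> carrier_mat d d"
  shows "mat_inner (A + B) C = mat_inner A C + mat_inner B C"
  using assms by (simp add: mat_inner_sum[where d=d] distrib_right sum.distrib)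

lemma mat_inner_minus_left:
  assumes "A \<in> carrier_mat d d" "B \<in> carrier_mat d d" "C \<in> carrier_mat d d"
  shows "mat_inner (A - B) C = mat_inner A C - mat_inner B C"
  using assms by (simp add: mat_inner_sum[where d=d] minus_carrier_mat left_diff_distrib sum_subtractf)

lemma mat_inner_smult_left:
  assumes "A \<in> carrier_mat d d" "C \<in> carrier_mat d d"
  shows "mat_inner (a \<cdot>\<^sub>m A) C = a * mat_inner A C"
  using assms by (simp add: mat_inner_sum[where d=d] sum_distrib_left mult.assoc)

lemma mat_inner_add_right:
  assumes "A \<in> carrier_mat d d" "B \<in> carrier_mat d d" "C \<in> carrier_mat d d"
  shows "mat_inner C (A + B) = mat_inner C A + mat_inner C B"
  using assms by (simp add: mat_inner_sum[where d=d] distrib_left sum.distrib)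

lemma mat_inner_uminus_right:
  assumes "A \<in> carrier_mat d d" "C \<in> carrier_mat d d"
  shows "mat_inner C (- A) = - mat_inner C A"
  using assms by (simp add: mat_inner_sum[where d=d] sum_negf)

lemma mat_inner_smult_right:
  assumes "A \<in> carrier_mat d d" "C \<in> carrier_mat d d"
  shows "mat_inner C (a \<cdot>\<^sub>m A) = a * mat_inner C A"
  using assms by (simp add: mat_inner_sum[where d=d] sum_distrib_left mult_ac)

lemma tr_mat_inner: "A \<in> carrier_mat d d \<Longrightarrow> tr A = mat_inner A (1\<^sub>m d)"
  by (simp add: mat_inner_def)

lemma outer_sym: "x \<in> carrier_vec d \<Longrightarrow> outer x \<in> sym_mats d"
  by (rule sym_matsI) (auto simp: outer_def)

lemma outer_index: "x \<in> carrier_vec d \<Longrightarrow> i < d \<Longrightarrow> j < d \<Longrightarrow> outer x $$ (i, j) = x $ i * x $ j"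
  by (auto simp: outer_def)

lemma mat_inner_outer:
  assumes "x \<in> carrier_vec d" "A \<in> carrier_mat d d"
  shows "mat_inner (outer x) A = x \<bullet> (A *\<^sub>v x)"
proof -
  have "mat_inner (outer x) A = (\<Sum>i<d. \<Sum>j<d. x $ i * x $ j * A $$ (j, i))"
    using assms by (simp add: mat_inner_sum[where d=d] outer_index[where d=d])
  also have "\<dots> = (\<Sum>j<d. \<Sum>i<d. x $ j * (A $$ (j, i) * x $ i))"
    by (subst sum.swap) (simp add: mult_ac)
  also have "\<dots> = x \<bullet> (A *\<^sub>v x)"
    using assms scalar_prod_sum[of x d "A *\<^sub>v x"]
    by (simp add: mult_mat_vec_sum sum_distrib_left del: index_mult_mat_vec)
  finally show ?thesis .
qed

lemma mat_inner_outer_outer: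
  assumes "x \<in> carrier_vec d" "y \<in> carrier_vec d"
  shows "mat_inner (outer x) (outer y) = (x \<bullet> y)\<^sup>2"
  using assms
  by (simp add: mat_inner_sum[where d=d] outer_index[where d=d] scalar_prod_sum[where d=d]
      power2_eq_square sum_product mult_ac)

lemma tr_outer: "x \<in> carrier_vec d \<Longrightarrow> tr (outer x) = x \<bullet> x"
  by (simp add: tr_def scalar_prod_sum outer_def)

lemma fro_norm_sq:
  assumes "A \<in> sym_mats d"
  shows "(fro_norm A)\<^sup>2 = mat_inner A A"
proof -
  note A = sym_matsD[OF assms]
  have "mat_inner A A = (\<Sum>i<d. \<Sum>j<d. (A $$ (i, j))\<^sup>2)"
    using A by (auto simp: mat_inner_sum power2_eq_square intro!: sum.cong)
  moreover have "(\<Sum>i<d. \<Sum>j<d. (A $$ (i, j))\<^sup>2) \<ge> 0" by (intro sum_nonneg) auto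
  ultimately show ?thesis using A(1) by (simp add: fro_norm_def)
qed

lemma fro_norm_nonneg: "fro_norm A \<ge> 0"
  unfolding fro_norm_def by (intro real_sqrt_ge_zero sum_nonneg) auto

lemma mat_inner_le_fro_norm:
  assumes A: "A \<in> sym_mats d" and B: "B \<in> sym_mats d"
  shows "\<bar>mat_inner A B\<bar> \<le> fro_norm A * fro_norm B"
proof -
  note cA = sym_matsD(1)[OF A] and cB = sym_matsD(1)[OF B]
  let ?P = "{..<d} \<times> {..<d}"
  have *: "mat_inner C D = (\<Sum>p\<in>?P. C $$ p * D $$ p)" if "C \<in> sym_mats d" "D \<in> sym_mats d" for C D
    using sym_matsD[OF that(1)] sym_matsD[OF that(2)]
    by (auto simp: mat_inner_sum sum.cartesian_product intro!: sum.cong)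
  have "(mat_inner A B)\<^sup>2 \<le> mat_inner A A * mat_inner B B"
    using Cauchy_Schwarz_ineq_sum[of "\<lambda>p. A $$ p" "\<lambda>p. B $$ p" ?P]
    by (simp add: * A B power2_eq_square)
  also have "\<dots> = (fro_norm A * fro_norm B)\<^sup>2"
    by (simp add: fro_norm_sq[OF A] fro_norm_sq[OF B] power_mult_distrib)
  finally show ?thesis
    using fro_norm_nonneg by (metis abs_le_square_iff abs_of_nonneg mult_nonneg_nonneg)
qed

lemma fro_norm_outer: "x \<in> carrier_vec d \<Longrightarrow> fro_norm (outer x) = x \<bullet> x"
proof -
  assume x: "x \<in> carrier_vec d"
  have "(fro_norm (outer x))\<^sup>2 = (x \<bullet> x)\<^sup>2"
    by (simp add: fro_norm_sq[OF outer_sym[OF x]] mat_inner_outer_outer[OF x x])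
  then show ?thesis
    using fro_norm_nonneg x by (simp add: scalar_prod_sum sum_nonneg)
qed

lemma mat_inner_mat_of_decomp:
  assumes "snd ` set D \<subseteq> carrier_vec d" "G \<in> carrier_mat d d"
  shows "mat_inner (mat_of_decomp d D) G = (\<Sum>(a, x)\<leftarrow>D. a * mat_inner (outer x) G)"
  using assms(1)
proof (induction D)
  case Nil
  then show ?case using assms(2) by (simp add: mat_of_decomp_def mat_inner_sum[where d=d])
next
  case (Cons b D)
  obtain a x where b: "b = (a, x)" by fastforce
  then show ?case
    using Cons mat_of_decomp_carrier[of D d] assms(2)
    by (simp add: mat_of_decomp_def mat_inner_add_left[where d=d] mat_inner_smult_left[where d=d])
qed

lemma mat_of_decomp_sym:
  assumes "snd ` set D \<subseteq> carrier_vec d"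
  shows "mat_of_decomp d D \<in> sym_mats d"
proof (rule sym_matsI)
  fix i j assume ij: "i < d" "j < d"
  show "mat_of_decomp d D $$ (i, j) = mat_of_decomp d D $$ (j, i)"
    unfolding mat_of_decomp_index[OF assms ij] mat_of_decomp_index[OF assms ij(2,1)]
    using assms ij
    by (intro arg_cong[where f = sum_list] map_cong) (auto simp: outer_index subset_iff)
qed (use assms in simp)

section \<open>Orthonormal eigenbases\<close>

definition eigenbasis :: "nat \<Rightarrow> real mat \<Rightarrow> (nat \<Rightarrow> real vec) \<Rightarrow> (nat \<Rightarrow> real) \<Rightarrow> bool" where
  "eigenbasis d A u \<mu> \<longleftrightarrow> (\<forall>j<d. u j \<in> carrier_vec d \<and> A *\<^sub>v u j = \<mu> j \<cdot>\<^sub>v u j) \<and>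
     (\<forall>i<d. \<forall>j<d. u i \<bullet> u j = (if i = j then 1 else 0))"

theorem spectral_theorem:
  assumes "A \<in> sym_mats d"
  shows "\<exists>u \<mu>. eigenbasis d A u \<mu>"
proof -
  note A = sym_matsD[OF assms]
  obtain u \<mu> where orth: "\<forall>i<d. \<forall>j<d. (\<Sum>l<d. u i l * u j l) = (if i = j then 1 else 0)"
    and eig: "\<forall>j<d. \<forall>i<d. (\<Sum>l<d. A $$ (i, l) * u j l) = \<mu> j * u j i"
    using orthonormal_eigenvectors[of d "\<lambda>i j. A $$ (i, j)" d] A(2) by blast
  have "eigenbasis d A (\<lambda>j. vec d (u j)) \<mu>"
    unfolding eigenbasis_def
    using orth eig A(1)
    by (auto simp: scalar_prod_sum[where d=d] mult_mat_vec_sum simp del: index_mult_mat_vec intro!: eq_vecI)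
  then show ?thesis by blast
qed

text \<open>With the basis vectors as rows of \<open>U\<close>, orthonormality says that the
  transpose is a right inverse of \<open>U\<close>; for a square matrix it is then also a left
  inverse, so the columns are orthonormal too.\<close>

lemma eigenbasis_complete:
  assumes "eigenbasis d A u \<mu>" "i < d" "l < d"
  shows "(\<Sum>j<d. u j $ i * u j $ l) = (if i = l then 1 else 0)"
proof -
  define U where "U = mat d d (\<lambda>(j, i). u j $ i)"
  have U: "U \<in> carrier_mat d d" by (simp add: U_def)
  have "U * transpose_mat U = 1\<^sub>m d"
  proof (rule eq_matI)
    fix i j assume "i < dim_row (1\<^sub>m d :: real mat)" "j < dim_col (1\<^sub>m d :: real mat)"
    then have ij: "i < d" "j < d" by auto
    have "(U * transpose_mat U) $$ (i, j) = (\<Sum>l<d. u i $ l * u j $ l)"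
      using ij by (simp add: U_def scalar_prod_def atLeast0LessThan)
    also have "\<dots> = u i \<bullet> u j"
      using ij assms(1) by (simp add: scalar_prod_sum[where d=d] eigenbasis_def)
    finally show "(U * transpose_mat U) $$ (i, j) = 1\<^sub>m d $$ (i, j)"
      using ij assms(1) by (simp add: eigenbasis_def)
  qed (simp_all add: U_def)
  then have "transpose_mat U * U = 1\<^sub>m d"
    using mat_mult_left_right_inverse[OF U] U by simp
  then have "(transpose_mat U * U) $$ (i, l) = 1\<^sub>m d $$ (i, l)" by simp
  then show ?thesis using assms(2,3) by (simp add: U_def scalar_prod_def atLeast0LessThan)
qed

lemma eigenbasis_parseval:
  assumes e: "eigenbasis d A u \<mu>" and z: "z \<in> carrier_vec d" and w: "w \<in> carrier_vec d"
  shows "z \<bullet> w = (\<Sum>j<d. (u j \<bullet> z) * (u j \<bullet> w))"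
proof -
  have u: "u j \<in> carrier_vec d" if "j < d" for j using e that by (simp add: eigenbasis_def)
  have "(\<Sum>j<d. (u j \<bullet> z) * (u j \<bullet> w)) =
      (\<Sum>j<d. (\<Sum>i<d. u j $ i * z $ i) * (\<Sum>l<d. u j $ l * w $ l))"
    using u z w by (simp add: scalar_prod_sum[where d=d])
  also have "\<dots> = (\<Sum>j<d. \<Sum>i<d. \<Sum>l<d. (u j $ i * u j $ l) * (z $ i * w $ l))"
    unfolding sum_product by (simp add: mult_ac)
  also have "\<dots> = (\<Sum>i<d. \<Sum>l<d. (\<Sum>j<d. u j $ i * u j $ l) * (z $ i * w $ l))"
    by (subst sum.swap, rule sum.cong[OF refl], subst sum.swap) (simp add: sum_distrib_right)
  also have "\<dots> = (\<Sum>i<d. \<Sum>l<d. (if i = l then 1 else 0) * (z $ i * w $ l))"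
    by (intro sum.cong refl) (simp add: eigenbasis_complete[OF e])
  also have "\<dots> = z \<bullet> w" using z w by (simp add: scalar_prod_sum if_distrib[of "\<lambda>z. z * _"] cong: if_cong)
  finally show ?thesis by simp
qed

lemma eigenbasis_index:
  assumes e: "eigenbasis d A u \<mu>" and A: "A \<in> carrier_mat d d" and "i < d" "l < d"
  shows "A $$ (i, l) = (\<Sum>j<d. \<mu> j * (u j $ i * u j $ l))"
proof -
  have u: "u j \<in> carrier_vec d" "A *\<^sub>v u j = \<mu> j \<cdot>\<^sub>v u j" if "j < d" for j
    using e that by (simp_all add: eigenbasis_def)
  have "(\<Sum>j<d. \<mu> j * (u j $ i * u j $ l)) = (\<Sum>j<d. (A *\<^sub>v u j) $ i * u j $ l)"
    using u \<open>i < d\<close> by (intro sum.cong refl) (simp add: carrier_vecD[OF u(1)] del: index_mult_mat_vec)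
  also have "\<dots> = (\<Sum>j<d. \<Sum>m<d. A $$ (i, m) * (u j $ m * u j $ l))"
    using u(1) A \<open>i < d\<close>
    by (intro sum.cong refl) (simp add: mult_mat_vec_sum[where d=d] sum_distrib_left sum_distrib_right mult_ac del: index_mult_mat_vec)
  also have "\<dots> = (\<Sum>m<d. A $$ (i, m) * (\<Sum>j<d. u j $ m * u j $ l))"
    by (subst sum.swap) (simp add: sum_distrib_left)
  also have "\<dots> = (\<Sum>m<d. A $$ (i, m) * (if m = l then 1 else 0))"
    by (intro sum.cong refl) (simp add: eigenbasis_complete[OF e _ \<open>l < d\<close>])
  also have "\<dots> = A $$ (i, l)" using \<open>l < d\<close> by (simp add: if_distrib[of "\<lambda>z. _ * z"] cong: if_cong)
  finally show ?thesis by simp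
qed

lemma eigenbasis_mat_inner:
  assumes e: "eigenbasis d A u \<mu>" and A: "A \<in> carrier_mat d d" and B: "B \<in> carrier_mat d d"
  shows "mat_inner A B = (\<Sum>j<d. \<mu> j * (u j \<bullet> (B *\<^sub>v u j)))"
proof -
  have u: "u j \<in> carrier_vec d" if "j < d" for j using e that by (simp add: eigenbasis_def)
  have "mat_inner A B = (\<Sum>i<d. \<Sum>l<d. \<Sum>j<d. \<mu> j * (u j $ i * u j $ l * B $$ (l, i)))"
    using A B by (simp add: mat_inner_sum eigenbasis_index[OF e A] sum_distrib_right sum_distrib_left mult_ac)
  also have "\<dots> = (\<Sum>j<d. \<mu> j * mat_inner (outer (u j)) B)"
  proof -
    have "(\<Sum>i<d. \<Sum>l<d. \<Sum>j<d. \<mu> j * (u j $ i * u j $ l * B $$ (l, i)))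
      = (\<Sum>i<d. \<Sum>j<d. \<Sum>l<d. \<mu> j * (u j $ i * u j $ l * B $$ (l, i)))"
      by (intro sum.cong refl sum.swap)
    also have "\<dots> = (\<Sum>j<d. \<Sum>i<d. \<Sum>l<d. \<mu> j * (u j $ i * u j $ l * B $$ (l, i)))"
      by (rule sum.swap)
    also have "\<dots> = (\<Sum>j<d. \<mu> j * mat_inner (outer (u j)) B)"
      using u B by (simp add: mat_inner_sum[where d=d] outer_index[where d=d] sum_distrib_left)
    finally show ?thesis .
  qed
  also have "\<dots> = (\<Sum>j<d. \<mu> j * (u j \<bullet> (B *\<^sub>v u j)))"
    using u B by (simp add: mat_inner_outer[where d=d])
  finally show ?thesis .
qed

lemma eigenbasis_quadratic_form:
  assumes e: "eigenbasis d A u \<mu>" and A: "A \<in> carrier_mat d d" and z: "z \<in> carrier_vec d"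
  shows "z \<bullet> (A *\<^sub>v z) = (\<Sum>j<d. \<mu> j * (u j \<bullet> z)\<^sup>2)"
proof -
  have u: "u j \<in> carrier_vec d" if "j < d" for j using e that by (simp add: eigenbasis_def)
  have "z \<bullet> (A *\<^sub>v z) = mat_inner A (outer z)"
    using z A by (simp add: mat_inner_outer[where d=d] mat_inner_comm[of A d])
  also have "\<dots> = (\<Sum>j<d. \<mu> j * mat_inner (outer (u j)) (outer z))"
    unfolding eigenbasis_mat_inner[OF e A outer_carrier[OF z]]
    using u z by (simp add: mat_inner_outer[where d=d])
  finally show ?thesis using u z by (simp add: mat_inner_outer_outer[where d=d])
qed

lemma eigenbasis_tr:
  assumes e: "eigenbasis d A u \<mu>" and A: "A \<in> carrier_mat d d"
  shows "tr A = (\<Sum>j<d. \<mu> j)"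
  unfolding tr_mat_inner[OF A] eigenbasis_mat_inner[OF e A one_carrier_mat]
  using e by (intro sum.cong refl) (simp add: eigenbasis_def)

text \<open>Any orthonormal basis is an eigenbasis of the identity, so the trace of an unrelated
  matrix can be read off in the eigenbasis of \<open>A\<close>.\<close>

lemma eigenbasis_tr':
  assumes e: "eigenbasis d A u \<mu>" and B: "B \<in> carrier_mat d d"
  shows "tr B = (\<Sum>j<d. u j \<bullet> (B *\<^sub>v u j))"
proof -
  have u: "u j \<in> carrier_vec d" if "j < d" for j using e that by (simp add: eigenbasis_def)
  have "eigenbasis d (1\<^sub>m d) u (\<lambda>_. 1)"
    using e by (auto simp: eigenbasis_def)
  from eigenbasis_mat_inner[OF this one_carrier_mat B]
  show ?thesis using B by (simp add: tr_mat_inner[OF B] mat_inner_comm[of B d])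
qed

lemma eigenbasis_spectrum:
  assumes e: "eigenbasis d A u \<mu>" and A: "A \<in> carrier_mat d d" and "j < d"
  shows "\<mu> j \<in> spectrum A"
proof -
  have "u j \<bullet> u j = 1" "u j \<in> carrier_vec d" "A *\<^sub>v u j = \<mu> j \<cdot>\<^sub>v u j" using e \<open>j < d\<close> by (auto simp: eigenbasis_def)
  moreover from this have "u j \<noteq> 0\<^sub>v d" by auto
  ultimately have "eigenvector A (u j) (\<mu> j)" using A by (auto simp: eigenvector_def)
  then show ?thesis by (auto simp: spectrum_def eigenvalue_def)
qed

text \<open>In an eigenbasis of \<open>A\<close> the left side is a sum of eigenvalues with
  nonnegative weights of total \<open>tr W\<close>. Oracle answers can thus be compared with every
  matrix of the spectrahedron, not only with those of rank one.\<close>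

lemma mat_inner_psd_le_eig_max:
  assumes W: "psd d W" and A: "A \<in> sym_mats d"
  shows "mat_inner W A \<le> eig_max A * tr W"
proof -
  note cA = sym_matsD(1)[OF A]
  have cW: "W \<in> carrier_mat d d" using W sym_matsD(1) by (auto simp: psd_def)
  obtain u \<mu> where e: "eigenbasis d A u \<mu>" using spectral_theorem[OF A] by blast
  have "mat_inner W A = (\<Sum>j<d. \<mu> j * (u j \<bullet> (W *\<^sub>v u j)))"
    using eigenbasis_mat_inner[OF e cA cW] mat_inner_comm[OF cA cW] by simp
  also have "\<dots> \<le> (\<Sum>j<d. eig_max A * (u j \<bullet> (W *\<^sub>v u j)))"
  proof (intro sum_mono mult_right_mono)
    fix j assume "j \<in> {..<d}"
    then show "\<mu> j \<le> eig_max A" "0 \<le> u j \<bullet> (W *\<^sub>v u j)"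
      using eigenbasis_spectrum[OF e cA] card_finite_spectrum(1)[OF cA] W e
      by (auto simp: eig_max_def psd_def eigenbasis_def)
  qed
  also have "\<dots> = eig_max A * tr W" by (simp add: eigenbasis_tr'[OF e cW] sum_distrib_left)
  finally show ?thesis .
qed

subsection \<open>Rank, smallest eigenvalue and decompositions\<close>

lemma eigenbasis_carrier: "eigenbasis d A u \<mu> \<Longrightarrow> j < d \<Longrightarrow> u j \<in> carrier_vec d"
  by (simp add: eigenbasis_def)

lemma eigenbasis_orthonormal:
  "eigenbasis d A u \<mu> \<Longrightarrow> i < d \<Longrightarrow> j < d \<Longrightarrow> u i \<bullet> u j = (if i = j then 1 else 0)"
  by (simp add: eigenbasis_def)

text \<open>Eigenvectors with nonzero eigenvalue are images of multiples of themselves, hence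
  independent vectors in the column space, whose dimension bounds their number.\<close>

lemma card_nonzero_eigenvalues_le_rank:
  assumes e: "eigenbasis d A u \<mu>" and A: "A \<in> carrier_mat d d"
  shows "card {j \<in> {..<d}. \<mu> j \<noteq> 0} \<le> vec_space.rank d A"
proof -
  interpret vec_space "TYPE(real)" d .
  define J where "J = {j \<in> {..<d}. \<mu> j \<noteq> 0}"
  define U where "U = u ` J"
  define W where "W = span (set (cols A))"
  note orth = eigenbasis_orthonormal[OF e]
  have J: "finite J" "\<And>j. j \<in> J \<Longrightarrow> j < d" by (auto simp: J_def)
  have u: "u j \<in> carrier_vec d" if "j \<in> J" for j using e J(2) that eigenbasis_carrier by blast
  have inj: "inj_on u J"
  proof (rule inj_onI)
    fix i j assume "i \<in> J" "j \<in> J" "u i = u j"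
    then show "i = j" using orth[of i j] orth[of i i] J(2) by (metis zero_neq_one)
  qed
  have cols: "set (cols A) \<subseteq> carrier_vec d" using cols_dim A by blast
  have UW: "U \<subseteq> W"
  proof
    fix w assume "w \<in> U"
    then obtain j where j: "j \<in> J" "w = u j" by (auto simp: U_def)
    have "A *\<^sub>v ((1 / \<mu> j) \<cdot>\<^sub>v u j) = (1 / \<mu> j) \<cdot>\<^sub>v (\<mu> j \<cdot>\<^sub>v u j)"
      using A e j J(2) by (simp add: mult_mat_vec[OF A] eigenbasis_def)
    also have "\<dots> = u j" using j by (simp add: J_def smult_smult_assoc)
    finally have "w \<in> col_space A"
      unfolding col_space_eq[OF A] using u[OF j(1)] A j(2) by auto
    then show "w \<in> W" by (simp add: W_def col_space_def)
  qed
  have U: "U \<subseteq> carrier_vec d" using u by (auto simp: U_def)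
  have li: "lin_indpt U"
  proof (rule finite_lin_indpt2)
    fix a assume 0: "lincomb a U = 0\<^sub>v d"
    show "\<forall>v\<in>U. a v = 0"
    proof
      fix v assume "v \<in> U"
      then obtain j where j: "j \<in> J" "v = u j" by (auto simp: U_def)
      have "0 = lincomb a U \<bullet> u j" using 0 u[OF j(1)] by simp
      also have "\<dots> = (\<Sum>w\<in>U. (a w \<cdot>\<^sub>v w) \<bullet> u j)"
        unfolding lincomb_def using U u[OF j(1)]
        by (subst finsum_scalar_prod_sum) (auto simp: module_vec_simps)
      also have "\<dots> = (\<Sum>i\<in>J. (a (u i) \<cdot>\<^sub>v u i) \<bullet> u j)"
        unfolding U_def using inj by (simp add: sum.reindex)
      also have "\<dots> = (\<Sum>i\<in>J. a (u i) * (if i = j then 1 else 0))"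
        using u j J(2) orth by (intro sum.cong refl) (simp add: smult_scalar_prod_distrib[OF u u[OF j(1)]])
      also have "\<dots> = a v" using j J(1) by (simp add: if_distrib[of "\<lambda>z. _ * z"] cong: if_cong)
      finally show "a v = 0" by simp
    qed
  qed (use J U in \<open>auto simp: U_def\<close>)
  have sub: "subspace class_ring W V"
    unfolding W_def by (rule span_is_subspace) (use cols in simp)
  interpret W: vectorspace class_ring "vs W" by (rule subspace_is_vs[OF sub])
  have fin: "W.fin_dim" unfolding W_def by (rule fin_dim_span_cols[OF A])
  have "W.lin_indpt U"
    using li span_li_not_depend(2)[OF UW] sub by (simp add: subspace_def)
  then have "card U \<le> W.dim"
    using W.li_le_dim(2)[OF fin] UW by simp
  then show ?thesis
    using card_image[OF inj] by (simp add: rank_def W_def U_def J_def)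
qed

lemma eigenbasis_eigenvalue:
  assumes e: "eigenbasis d A u \<mu>" and j: "j < d"
  shows "\<mu> j = u j \<bullet> (A *\<^sub>v u j)"
  using e j eigenbasis_carrier[OF e j] by (simp add: eigenbasis_def)

lemma eigenbasis_psd_nonneg:
  assumes e: "eigenbasis d A u \<mu>" and A: "psd d A" and j: "j < d"
  shows "\<mu> j \<ge> 0"
  using A eigenbasis_carrier[OF e j] by (simp add: eigenbasis_eigenvalue[OF e j] psd_def)

lemma spectrahedronD:
  assumes "X \<in> spectrahedron d"
  shows "X \<in> carrier_mat d d" "X \<in> sym_mats d" "psd d X" "tr X = 1"
  using assms sym_matsD by (auto simp: spectrahedron_def)

lemma eig_min_nonzero_le:
  assumes e: "eigenbasis d A u \<mu>" and A: "A \<in> carrier_mat d d" and "j < d" "\<mu> j \<noteq> 0"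
  shows "eig_min_nonzero A \<le> \<mu> j"
  unfolding eig_min_nonzero_def
  using card_finite_spectrum(1)[OF A] eigenbasis_spectrum[OF e A \<open>j < d\<close>] \<open>\<mu> j \<noteq> 0\<close>
  by (intro Min_le) auto

text \<open>Trace one forces a nonzero eigenvalue, so the minimum is over a nonempty finite set and
  is attained. Positivity comes from the quadratic form at an eigenvector, the bound 1 from
  nonnegative eigenvalues of sum 1.\<close>

lemma eig_min_nonzero_spectrahedron:
  assumes A: "A \<in> spectrahedron d"
  shows "0 < eig_min_nonzero A" "eig_min_nonzero A \<le> 1"
proof -
  note AD = spectrahedronD[OF A]
  obtain u \<mu> where e: "eigenbasis d A u \<mu>" using spectral_theorem[OF AD(2)] by blast
  have sum: "(\<Sum>j<d. \<mu> j) = 1" using eigenbasis_tr[OF e AD(1)] AD(4) by simp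
  then obtain j where j: "j < d" "\<mu> j \<noteq> 0" by (metis lessThan_iff sum.neutral zero_neq_one)
  have "\<mu> j \<le> (\<Sum>j<d. \<mu> j)"
    using j eigenbasis_psd_nonneg[OF e AD(3)] by (intro member_le_sum) auto
  then show "eig_min_nonzero A \<le> 1" using eig_min_nonzero_le[OF e AD(1) j] sum by simp
  have "spectrum A - {0} \<noteq> {}" using eigenbasis_spectrum[OF e AD(1) j(1)] j(2) by auto
  then have "eig_min_nonzero A \<in> spectrum A - {0}"
    unfolding eig_min_nonzero_def using card_finite_spectrum(1)[OF AD(1)] by (intro Min_in) auto
  then obtain v where v: "v \<in> carrier_vec d" "v \<noteq> 0\<^sub>v d" "A *\<^sub>v v = eig_min_nonzero A \<cdot>\<^sub>v v"
    and nz: "eig_min_nonzero A \<noteq> 0"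
    using AD(1) by (auto simp: spectrum_def eigenvalue_def eigenvector_def)
  have "0 \<le> v \<bullet> (A *\<^sub>v v)" using AD(3) v(1) by (simp add: psd_def)
  then have "0 \<le> eig_min_nonzero A * (v \<bullet> v)" using v by simp
  moreover have "v \<bullet> v > 0"
  proof -
    obtain i where "i < d" "v $ i \<noteq> 0" using v(1,2) by (metis eq_vecI carrier_vecD index_zero_vec)
    then have "0 < v $ i * v $ i" by (meson not_real_square_gt_zero)
    then show ?thesis unfolding scalar_prod_sum[OF v(1) v(1)]
      using \<open>i < d\<close> by (intro sum_pos2[of _ i]) auto
  qed
  ultimately show "0 < eig_min_nonzero A" using nz by (simp add: zero_le_mult_iff)
qed

section \<open>Averages over a decomposition\<close>

definition weighted_sum :: "decomposition \<Rightarrow> (real vec \<Rightarrow> real) \<Rightarrow> real" where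
  "weighted_sum D F = (\<Sum>(a, x)\<leftarrow>D. a * F x)"

lemma weighted_sum_add: "weighted_sum D (\<lambda>x. F x + G x) = weighted_sum D F + weighted_sum D G"
  unfolding weighted_sum_def by (induction D) (auto simp: algebra_simps)

lemma weighted_sum_diff: "weighted_sum D (\<lambda>x. F x - G x) = weighted_sum D F - weighted_sum D G"
  unfolding weighted_sum_def by (induction D) (auto simp: algebra_simps)

lemma weighted_sum_cmult: "weighted_sum D (\<lambda>x. c * F x) = c * weighted_sum D F"
  unfolding weighted_sum_def by (induction D) (auto simp: algebra_simps)

lemma weighted_sum_const: "weighted_sum D (\<lambda>x. c) = c * (\<Sum>(a, x)\<leftarrow>D. a)"
  unfolding weighted_sum_def by (induction D) (auto simp: algebra_simps)

lemma weighted_sum_sum: "weighted_sum D (\<lambda>x. \<Sum>j\<in>J. F j x) = (\<Sum>j\<in>J. weighted_sum D (F j))"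
  unfolding weighted_sum_def by (induction D) (auto simp: sum.distrib sum_distrib_left)

definition unit_decomp :: "nat \<Rightarrow> decomposition \<Rightarrow> bool" where
  "unit_decomp d D \<longleftrightarrow> (\<forall>(a, x)\<in>set D. 0 \<le> a \<and> x \<in> unit_vecs d) \<and> (\<Sum>(a, x)\<leftarrow>D. a) = 1"

lemma unit_vecsD: "x \<in> unit_vecs d \<Longrightarrow> x \<in> carrier_vec d" "x \<in> unit_vecs d \<Longrightarrow> x \<bullet> x = 1"
  by (auto simp: unit_vecs_def)

lemma unit_decomp_carrier: "unit_decomp d D \<Longrightarrow> snd ` set D \<subseteq> carrier_vec d"
  by (fastforce simp: unit_decomp_def dest: unit_vecsD)

lemma weighted_sum_mono:
  assumes "unit_decomp d D" "\<And>x. x \<in> unit_vecs d \<Longrightarrow> F x \<le> G x"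
  shows "weighted_sum D F \<le> weighted_sum D G"
  unfolding weighted_sum_def
  by (rule sum_list_mono) (use assms in \<open>auto simp: unit_decomp_def intro!: mult_left_mono\<close>)

lemma weighted_sum_cong:
  assumes "unit_decomp d D" "\<And>x. x \<in> unit_vecs d \<Longrightarrow> F x = G x"
  shows "weighted_sum D F = weighted_sum D G"
  using weighted_sum_mono[OF assms(1), of F G] weighted_sum_mono[OF assms(1), of G F] assms(2)
  by force

lemma weighted_sum_unit_const: "unit_decomp d D \<Longrightarrow> weighted_sum D (\<lambda>x. c) = c"
  by (simp add: weighted_sum_const unit_decomp_def)

lemma mat_inner_mat_of_decomp_weighted_sum:
  assumes "snd ` set D \<subseteq> carrier_vec d" "G \<in> carrier_mat d d"
  shows "mat_inner (mat_of_decomp d D) G = weighted_sum D (\<lambda>x. mat_inner (outer x) G)"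
  using mat_inner_mat_of_decomp[OF assms] by (simp add: weighted_sum_def)

section \<open>Positive semidefinite matrices\<close>

lemma psd_iff:
  assumes "A \<in> sym_mats d"
  shows "psd d A \<longleftrightarrow> (\<forall>z\<in>carrier_vec d. 0 \<le> mat_inner A (outer z))"
proof -
  have "mat_inner A (outer z) = z \<bullet> (A *\<^sub>v z)" if "z \<in> carrier_vec d" for z
    using mat_inner_outer[OF that] mat_inner_comm[OF _ outer_carrier[OF that]] sym_matsD(1)[OF assms]
    by simp
  then show ?thesis using assms by (simp add: psd_def)
qed

lemma psdI:
  "A \<in> sym_mats d \<Longrightarrow> (\<And>z. z \<in> carrier_vec d \<Longrightarrow> 0 \<le> mat_inner A (outer z)) \<Longrightarrow> psd d A"
  by (simp add: psd_iff)

lemma psdD: "psd d A \<Longrightarrow> z \<in> carrier_vec d \<Longrightarrow> 0 \<le> mat_inner A (outer z)"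
  using psd_iff[of A d] by (simp add: psd_def)

lemma sym_mats_add:
  assumes "A \<in> sym_mats d" "B \<in> sym_mats d"
  shows "A + B \<in> sym_mats d"
  using sym_matsD(1)[OF assms(1)] sym_matsD(1)[OF assms(2)]
  by (intro sym_matsI) (simp_all add: sym_matsD(2)[OF assms(1)] sym_matsD(2)[OF assms(2)])

lemma sym_mats_minus:
  assumes "A \<in> sym_mats d" "B \<in> sym_mats d"
  shows "A - B \<in> sym_mats d"
  using sym_matsD(1)[OF assms(1)] sym_matsD(1)[OF assms(2)]
  by (intro sym_matsI)
    (simp_all add: minus_carrier_mat sym_matsD(2)[OF assms(1)] sym_matsD(2)[OF assms(2)])

lemma sym_mats_smult:
  assumes "A \<in> sym_mats d"
  shows "a \<cdot>\<^sub>m A \<in> sym_mats d"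
  using sym_matsD(1)[OF assms] by (intro sym_matsI) (simp_all add: sym_matsD(2)[OF assms])

lemma sym_mats_uminus:
  assumes "A \<in> sym_mats d"
  shows "- A \<in> sym_mats d"
  using sym_matsD(1)[OF assms] by (intro sym_matsI) (simp_all add: sym_matsD(2)[OF assms])

lemma psd_combination:
  assumes "psd d A" "psd d B" "0 \<le> a" "0 \<le> b"
  shows "psd d (a \<cdot>\<^sub>m A + b \<cdot>\<^sub>m B)"
proof (rule psdI)
  have s: "A \<in> sym_mats d" "B \<in> sym_mats d" using assms by (auto simp: psd_def)
  then show "a \<cdot>\<^sub>m A + b \<cdot>\<^sub>m B \<in> sym_mats d" by (intro sym_mats_add sym_mats_smult)
  fix z :: "real vec" assume "z \<in> carrier_vec d"
  then show "0 \<le> mat_inner (a \<cdot>\<^sub>m A + b \<cdot>\<^sub>m B) (outer z)"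
    using assms psdD sym_matsD(1)[OF s(1)] sym_matsD(1)[OF s(2)]
    by (simp add: mat_inner_add_left[where d=d] mat_inner_smult_left[where d=d])
qed

lemma psd_outer: "x \<in> carrier_vec d \<Longrightarrow> psd d (outer x)"
  by (rule psdI) (auto simp: outer_sym mat_inner_outer_outer)

lemma outer_in_spectrahedron:
  assumes "x \<in> unit_vecs d"
  shows "outer x \<in> spectrahedron d"
  using unit_vecsD[OF assms] by (simp add: spectrahedron_def outer_sym psd_outer tr_outer[where d=d])

lemma tr_combination:
  assumes "A \<in> carrier_mat d d" "B \<in> carrier_mat d d"
  shows "tr (a \<cdot>\<^sub>m A + b \<cdot>\<^sub>m B) = a * tr A + b * tr B"
  using assms
  by (simp add: tr_mat_inner[where d=d] mat_inner_add_left[where d=d] mat_inner_smult_left[where d=d])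

lemma mat_of_decomp_in_spectrahedron:
  assumes D: "unit_decomp d D"
  shows "mat_of_decomp d D \<in> spectrahedron d"
proof -
  note c = unit_decomp_carrier[OF D]
  have "psd d (mat_of_decomp d D)"
  proof (rule psdI[OF mat_of_decomp_sym[OF c]])
    fix z :: "real vec" assume z: "z \<in> carrier_vec d"
    have "weighted_sum D (\<lambda>x. 0) \<le> weighted_sum D (\<lambda>x. mat_inner (outer x) (outer z))"
      by (rule weighted_sum_mono[OF D]) (use z unit_vecsD(1) in \<open>simp add: mat_inner_outer_outer[where d=d]\<close>)
    then show "0 \<le> mat_inner (mat_of_decomp d D) (outer z)"
      using z by (simp add: mat_inner_mat_of_decomp_weighted_sum[OF c] weighted_sum_unit_const[OF D])
  qed
  moreover have "tr (mat_of_decomp d D) = weighted_sum D (\<lambda>x. 1)"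
    unfolding tr_mat_inner[OF mat_of_decomp_carrier[OF c]] mat_inner_mat_of_decomp_weighted_sum[OF c one_carrier_mat]
    by (rule weighted_sum_cong[OF D]) (simp add: unit_vecsD tr_outer[where d=d] tr_mat_inner[symmetric, where d=d])
  ultimately show ?thesis
    using mat_of_decomp_sym[OF c] weighted_sum_unit_const[OF D] by (simp add: spectrahedron_def)
qed

subsection \<open>Transport between a decomposition and a matrix\<close>

text \<open>The orthogonal projection \<open>P\<close> onto the span of the \<open>u j\<close> with
  \<open>j\<close> in \<open>J\<close>. As a map of vectors it applies to each component, turning a
  decomposition of \<open>X\<close> into one of \<open>PXP\<close>.\<close>

definition eigenprojection :: "nat \<Rightarrow> (nat \<Rightarrow> real vec) \<Rightarrow> nat set \<Rightarrow> real vec \<Rightarrow> real vec" where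
  "eigenprojection d u J x = vec d (\<lambda>i. \<Sum>j\<in>J. (u j \<bullet> x) * u j $ i)"

lemma eigenprojection_carrier [simp]: "eigenprojection d u J x \<in> carrier_vec d"
  by (simp add: eigenprojection_def)

lemma eigenprojection_scalar_prod:
  assumes e: "eigenbasis d A u \<mu>" and J: "J \<subseteq> {..<d}" and z: "z \<in> carrier_vec d"
  shows "z \<bullet> eigenprojection d u J x = (\<Sum>j\<in>J. (u j \<bullet> x) * (u j \<bullet> z))"
proof -
  have u: "u j \<in> carrier_vec d" if "j \<in> J" for j using eigenbasis_carrier[OF e] J that by blast
  have "z \<bullet> eigenprojection d u J x = (\<Sum>i<d. \<Sum>j\<in>J. (u j \<bullet> x) * (u j $ i * z $ i))"
    using z by (simp add: scalar_prod_sum[where d=d]) (simp add: eigenprojection_def sum_distrib_left mult_ac)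
  also have "\<dots> = (\<Sum>j\<in>J. (u j \<bullet> x) * (\<Sum>i<d. u j $ i * z $ i))"
    by (subst sum.swap) (simp add: sum_distrib_left)
  also have "\<dots> = (\<Sum>j\<in>J. (u j \<bullet> x) * (u j \<bullet> z))"
    using u z by (intro sum.cong refl) (simp add: scalar_prod_sum[where d=d])
  finally show ?thesis .
qed

lemma eigenprojection_coordinate:
  assumes e: "eigenbasis d A u \<mu>" and J: "J \<subseteq> {..<d}" and i: "i < d"
  shows "u i \<bullet> eigenprojection d u J x = (if i \<in> J then u i \<bullet> x else 0)"
proof -
  have fin: "finite J" using J finite_subset by blast
  have "u i \<bullet> eigenprojection d u J x = (\<Sum>j\<in>J. (u j \<bullet> x) * (if j = i then 1 else 0))"
    unfolding eigenprojection_scalar_prod[OF e J eigenbasis_carrier[OF e i]]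
    using i J by (intro sum.cong refl) (auto simp: eigenbasis_orthonormal[OF e] subset_iff)
  then show ?thesis using fin by (simp add: if_distrib[of "\<lambda>z. _ * z"] cong: if_cong)
qed

lemma eigenprojection_self_adjoint:
  assumes e: "eigenbasis d A u \<mu>" and J: "J \<subseteq> {..<d}"
    and x: "x \<in> carrier_vec d" and z: "z \<in> carrier_vec d"
  shows "eigenprojection d u J x \<bullet> z = x \<bullet> eigenprojection d u J z"
  using comm_scalar_prod[OF eigenprojection_carrier z, of u J x]
  by (simp add: eigenprojection_scalar_prod[OF e J x] eigenprojection_scalar_prod[OF e J z] mult.commute)

lemma eigenprojection_norm:
  assumes e: "eigenbasis d A u \<mu>" and J: "J \<subseteq> {..<d}" and x: "x \<in> carrier_vec d"
  shows "eigenprojection d u J x \<bullet> eigenprojection d u J x = (\<Sum>j\<in>J. (u j \<bullet> x)\<^sup>2)"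
  using J unfolding eigenprojection_scalar_prod[OF e J eigenprojection_carrier]
  by (intro sum.cong refl) (auto simp: eigenprojection_coordinate[OF e J] power2_eq_square subset_iff)

lemma sum_coordinates_le_norm:
  assumes e: "eigenbasis d A u \<mu>" and J: "J \<subseteq> {..<d}" and x: "x \<in> carrier_vec d"
  shows "(\<Sum>j\<in>J. (u j \<bullet> x)\<^sup>2) \<le> x \<bullet> x"
  unfolding eigenbasis_parseval[OF e x x] power2_eq_square
  using J by (intro sum_mono2) auto

text \<open>Cauchy-Schwarz against the projection matrix, the sum of the \<open>outer (u j)\<close>
  over \<open>J\<close>, whose Frobenius norm is \<open>sqrt (card J)\<close>.\<close>

lemma sum_eigendirections_le_fro_norm:
  assumes e: "eigenbasis d A u \<mu>" and J: "J \<subseteq> {..<d}" and M: "M \<in> sym_mats d"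
  shows "\<bar>\<Sum>j\<in>J. mat_inner M (outer (u j))\<bar> \<le> sqrt (card J) * fro_norm M"
proof -
  have fin: "finite J" using J finite_subset by blast
  have u: "u j \<in> carrier_vec d" if "j \<in> J" for j using eigenbasis_carrier[OF e] J that by blast
  note cM = sym_matsD(1)[OF M]
  \<comment> \<open>The projection matrix is encoded as a list with all weights 1, so that the
    formulas for \<open>mat_of_decomp\<close> apply to it.\<close>
  define D where "D = map (\<lambda>j. (1 :: real, u j)) (sorted_list_of_set J)"
  have D: "snd ` set D \<subseteq> carrier_vec d" using u fin by (auto simp: D_def)
  have wD: "weighted_sum D F = (\<Sum>j\<in>J. F (u j))" for F
    unfolding weighted_sum_def D_def
    by (simp add: o_def sum_list_distinct_conv_sum_set fin)
  note N = mat_of_decomp_sym[OF D]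
  have inner: "mat_inner (mat_of_decomp d D) G = (\<Sum>j\<in>J. mat_inner (outer (u j)) G)"
    if "G \<in> carrier_mat d d" for G
    by (simp add: mat_inner_mat_of_decomp_weighted_sum[OF D that] wD)
  have "(fro_norm (mat_of_decomp d D))\<^sup>2 = (\<Sum>j\<in>J. mat_inner (mat_of_decomp d D) (outer (u j)))"
    using inner[OF sym_matsD(1)[OF N]] mat_inner_comm[OF sym_matsD(1)[OF N]] u
    by (simp add: fro_norm_sq[OF N])
  also have "\<dots> = (\<Sum>j\<in>J. \<Sum>i\<in>J. if i = j then 1 else 0)"
    using u inner J
    by (intro sum.cong refl) (auto simp: mat_inner_outer_outer[where d=d] eigenbasis_orthonormal[OF e] subset_iff intro!: sum.cong)
  also have "\<dots> = card J" using fin by simp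
  finally have "fro_norm (mat_of_decomp d D) = sqrt (card J)"
    using fro_norm_nonneg real_sqrt_unique by metis
  moreover have "(\<Sum>j\<in>J. mat_inner M (outer (u j))) = mat_inner (mat_of_decomp d D) M"
    using inner[OF cM] u mat_inner_comm[OF cM] by simp
  ultimately show ?thesis using mat_inner_le_fro_norm[OF N M] by simp
qed

text \<open>\<open>W x\<close> is what the oracle's answer is compared with when \<open>x\<close> is
  drawn, so it has to average to \<open>Y\<close> and still overlap with \<open>outer x\<close>. The
  projected component carries the overlap; a multiple of the remainder \<open>R\<close> supplies the
  missing trace.\<close>

lemma spectrahedron_transport:
  assumes Y: "Y \<in> spectrahedron d" and e: "eigenbasis d Y u \<mu>"
    and D: "unit_decomp d D" and J: "J \<subseteq> {..<d}"
    and \<tau>: "0 < \<tau>" "\<And>j. j \<in> J \<Longrightarrow> \<tau> \<le> \<mu> j"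
    and \<Delta>: "0 < \<Delta>" "fro_norm (mat_of_decomp d D - Y) \<le> \<Delta>"
  obtains W where "\<And>x. x \<in> unit_vecs d \<Longrightarrow> W x \<in> spectrahedron d"
    and "\<And>G. G \<in> carrier_mat d d \<Longrightarrow> weighted_sum D (\<lambda>x. mat_inner (W x) G) = mat_inner Y G"
    and "weighted_sum D (\<lambda>x. 1 - mat_inner (W x) (outer x))
           \<le> \<Delta> / \<tau> + 2 * (1 - (\<Sum>j\<in>J. \<mu> j) + sqrt (card J) * \<Delta>)"
proof -
  define X where "X = mat_of_decomp d D"
  define P where "P = eigenprojection d u J"
  define n where "n x = (\<Sum>j\<in>J. (u j \<bullet> x)\<^sup>2)" for x
  define \<gamma> where "\<gamma> = 1 / (1 + \<Delta> / \<tau>)"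
  define E where "E = map (\<lambda>(a, x). (\<gamma> * a, P x)) D"
  define R where "R = Y - mat_of_decomp d E"
  define T where "T = weighted_sum D n"
  \<comment> \<open>The trace of \<open>outer (P x)\<close> is \<open>n x\<close> for a unit vector
    \<open>x\<close>, so the coefficient of \<open>R\<close> brings the total trace to 1.\<close>
  define W where "W x = \<gamma> \<cdot>\<^sub>m outer (P x) + ((1 - \<gamma> * n x) / tr R) \<cdot>\<^sub>m R" for x
  note YD = spectrahedronD[OF Y]
  note cD = unit_decomp_carrier[OF D]
  have XS: "X \<in> sym_mats d" unfolding X_def by (rule mat_of_decomp_sym[OF cD])
  have XY: "X - Y \<in> sym_mats d" by (rule sym_mats_minus[OF XS YD(2)])
  have fin: "finite J" using J finite_subset by blast
  have u: "u j \<in> carrier_vec d" if "j \<in> J" for j using eigenbasis_carrier[OF e] J that by blast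
  have \<gamma>: "0 < \<gamma>" "\<gamma> < 1" "\<gamma> * (1 + \<Delta> / \<tau>) = 1" "1 - \<gamma> \<le> \<Delta> / \<tau>"
  proof -
    have q: "\<Delta> / \<tau> > 0" using \<Delta> \<tau> by simp
    then show "0 < \<gamma>" "\<gamma> < 1" "\<gamma> * (1 + \<Delta> / \<tau>) = 1" by (simp_all add: \<gamma>_def)
    have "1 - \<gamma> = \<gamma> * (\<Delta> / \<tau>)" using \<open>\<gamma> * (1 + \<Delta> / \<tau>) = 1\<close> by (simp add: algebra_simps)
    also have "\<dots> \<le> 1 * (\<Delta> / \<tau>)" using q \<open>\<gamma> < 1\<close> by (intro mult_right_mono) auto
    finally show "1 - \<gamma> \<le> \<Delta> / \<tau>" by simp
  qed
  have Pc: "P x \<in> carrier_vec d" for x by (simp add: P_def)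
  have PP: "P x \<bullet> P x = n x" if "x \<in> carrier_vec d" for x
    unfolding P_def n_def by (rule eigenprojection_norm[OF e J that])
  have Px: "P x \<bullet> x = n x" if "x \<in> carrier_vec d" for x
    using eigenprojection_self_adjoint[OF e J that that] eigenprojection_scalar_prod[OF e J that]
    by (simp add: P_def n_def power2_eq_square)
  have n: "0 \<le> n x" "x \<in> unit_vecs d \<Longrightarrow> n x \<le> 1" for x
    using sum_coordinates_le_norm[OF e J, of x] unit_vecsD[of x d]
    by (simp_all add: n_def sum_nonneg)
  have cE: "snd ` set E \<subseteq> carrier_vec d" using Pc by (auto simp: E_def)
  have ES: "mat_of_decomp d E \<in> sym_mats d" by (rule mat_of_decomp_sym[OF cE])
  have RS: "R \<in> sym_mats d" unfolding R_def by (rule sym_mats_minus[OF YD(2) ES])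
  note cR = sym_matsD(1)[OF RS]
  have wE: "weighted_sum E F = \<gamma> * weighted_sum D (\<lambda>x. F (P x))" for F
    unfolding weighted_sum_def E_def by (induction D) (auto simp: algebra_simps)
  have R_inner: "mat_inner R G = mat_inner Y G - \<gamma> * weighted_sum D (\<lambda>x. mat_inner (outer (P x)) G)"
    if "G \<in> carrier_mat d d" for G
    unfolding R_def mat_inner_minus_left[OF YD(1) sym_matsD(1)[OF ES] that]
      mat_inner_mat_of_decomp_weighted_sum[OF cE that] wE ..
  have R_psd: "psd d R"
  proof (rule psdI[OF RS])
    fix z :: "real vec" assume z: "z \<in> carrier_vec d"
    let ?s = "\<Sum>j\<in>J. \<mu> j * (u j \<bullet> z)\<^sup>2"
    have nonneg: "\<mu> j * (u j \<bullet> z)\<^sup>2 \<ge> 0" if "j < d" for j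
      using eigenbasis_psd_nonneg[OF e YD(3) that] by simp
    have Yz: "mat_inner Y (outer z) = (\<Sum>j<d. \<mu> j * (u j \<bullet> z)\<^sup>2)" if "z \<in> carrier_vec d" for z
      using eigenbasis_quadratic_form[OF e YD(1) that] mat_inner_outer[OF that YD(1)]
        mat_inner_comm[OF YD(1) outer_carrier[OF that]] by simp
    have s_le: "?s \<le> mat_inner Y (outer z)"
      unfolding Yz[OF z] using J nonneg by (intro sum_mono2) auto
    have "mat_inner Y (outer (P z)) = (\<Sum>j<d. if j \<in> J then \<mu> j * (u j \<bullet> z)\<^sup>2 else 0)"
      unfolding Yz[OF Pc] by (intro sum.cong refl) (simp add: P_def eigenprojection_coordinate[OF e J])
    also have "\<dots> = ?s" using J by (simp add: sum.If_cases Int_absorb1)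
    finally have YP: "mat_inner Y (outer (P z)) = ?s" .
    have "\<tau> * n z \<le> ?s"
      unfolding n_def sum_distrib_left using \<tau>(2) by (intro sum_mono mult_right_mono) auto
    then have nz: "n z \<le> ?s / \<tau>" using \<tau>(1) by (simp add: field_simps)
    \<comment> \<open>Moving \<open>P\<close> from the components to \<open>z\<close> turns the form
      of \<open>PXP\<close> at \<open>z\<close> into that of \<open>X\<close> at \<open>P z\<close>.
      Replacing \<open>X\<close> by \<open>Y\<close> there costs \<open>\<Delta> * n z\<close>, at
      most \<open>\<Delta> / \<tau>\<close> times \<open>?s\<close>, because the eigenvalues in
      \<open>J\<close> are at least \<open>\<tau>\<close>.\<close>
    have "weighted_sum D (\<lambda>x. mat_inner (outer (P x)) (outer z))
        = weighted_sum D (\<lambda>x. mat_inner (outer x) (outer (P z)))"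
      using z eigenprojection_self_adjoint[OF e J _ z]
      by (intro weighted_sum_cong[OF D])
        (simp add: mat_inner_outer_outer[where d=d] Pc unit_vecsD, simp add: P_def unit_vecsD)
    also have "\<dots> = mat_inner X (outer (P z))"
      unfolding X_def by (rule mat_inner_mat_of_decomp_weighted_sum[symmetric, OF cD outer_carrier[OF Pc]])
    also have "\<dots> = mat_inner Y (outer (P z)) + mat_inner (X - Y) (outer (P z))"
      using mat_inner_minus_left[OF sym_matsD(1)[OF XS] YD(1) outer_carrier[OF Pc]] by simp
    also have "mat_inner (X - Y) (outer (P z)) \<le> fro_norm (X - Y) * fro_norm (outer (P z))"
      using mat_inner_le_fro_norm[OF XY outer_sym[OF Pc]] abs_le_D1 by blast
    also have "\<dots> \<le> \<Delta> * n z"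
      using \<Delta>(2) n(1) unfolding fro_norm_outer[OF Pc] PP[OF z]
      by (intro mult_right_mono) (simp_all add: X_def)
    also have "\<dots> \<le> \<Delta> * (?s / \<tau>)" using nz \<Delta>(1) by (intro mult_left_mono) auto
    finally have "weighted_sum D (\<lambda>x. mat_inner (outer (P x)) (outer z)) \<le> (1 + \<Delta> / \<tau>) * ?s"
      by (simp add: YP algebra_simps)
    from mult_left_mono[OF this, of \<gamma>]
    have "\<gamma> * weighted_sum D (\<lambda>x. mat_inner (outer (P x)) (outer z)) \<le> ?s"
      using \<gamma>(1,3) by (simp flip: mult.assoc)
    then show "0 \<le> mat_inner R (outer z)" using s_le by (simp add: R_inner[OF outer_carrier[OF z]])
  qed
  have trR: "tr R = 1 - \<gamma> * T"
  proof -
    have "weighted_sum D (\<lambda>x. mat_inner (outer (P x)) (1\<^sub>m d)) = T"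
      unfolding T_def
      by (intro weighted_sum_cong[OF D])
        (simp add: tr_mat_inner[symmetric, OF outer_carrier[OF Pc]] tr_outer[OF Pc] PP unit_vecsD)
    then show ?thesis
      using R_inner[OF one_carrier_mat] YD(4) by (simp add: tr_mat_inner[OF cR] tr_mat_inner[OF YD(1)])
  qed
  have T: "0 \<le> T" "T \<le> 1"
    using weighted_sum_mono[OF D, of n "\<lambda>x. 1"] weighted_sum_mono[OF D, of "\<lambda>x. 0" n] n
    by (simp_all add: T_def weighted_sum_unit_const[OF D])
  \<comment> \<open>Positivity of \<open>\<Delta>\<close> makes \<open>\<gamma>\<close> strictly
    less than 1, which keeps the denominator in \<open>W\<close> away from 0.\<close>
  have trR_pos: "tr R > 0"
  proof -
    have "\<gamma> * T \<le> \<gamma> * 1" using T \<gamma> by (intro mult_left_mono) auto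
    then show ?thesis using \<gamma>(2) trR by linarith
  qed
  have \<gamma>n: "\<gamma> * n x \<le> 1" if "x \<in> unit_vecs d" for x
    using mult_mono[of \<gamma> 1 "n x" 1] \<gamma> n that by simp
  have W_inner: "mat_inner (W x) G = \<gamma> * mat_inner (outer (P x)) G + (1 - \<gamma> * n x) / tr R * mat_inner R G"
    if "G \<in> carrier_mat d d" for G x
    unfolding W_def using that cR Pc
    by (simp add: mat_inner_add_left[where d=d] mat_inner_smult_left[where d=d])
  show ?thesis
  proof (rule that)
    fix x assume x: "x \<in> unit_vecs d"
    have c: "0 \<le> (1 - \<gamma> * n x) / tr R" using \<gamma>n[OF x] trR_pos by simp
    have "psd d (W x)" unfolding W_def
      using psd_combination[OF psd_outer[OF Pc] R_psd] \<gamma>(1) c by simp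
    moreover have "tr (W x) = 1"
      unfolding W_def tr_combination[OF outer_carrier[OF Pc] cR] tr_outer[OF Pc]
      using trR_pos by (simp add: PP unit_vecsD[OF x])
    ultimately show "W x \<in> spectrahedron d" by (simp add: spectrahedron_def psd_def)
  next
    fix G :: "real mat" assume G: "G \<in> carrier_mat d d"
    have "weighted_sum D (\<lambda>x. mat_inner (W x) G) = weighted_sum D
        (\<lambda>x. \<gamma> * mat_inner (outer (P x)) G + mat_inner R G / tr R * (1 - \<gamma> * n x))"
      by (intro weighted_sum_cong[OF D]) (simp add: W_inner[OF G])
    also have "\<dots> = \<gamma> * weighted_sum D (\<lambda>x. mat_inner (outer (P x)) G)
        + weighted_sum D (\<lambda>x. mat_inner R G / tr R * (1 - \<gamma> * n x))"
      unfolding weighted_sum_add weighted_sum_cmult ..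
    \<comment> \<open>The factors \<open>1 - \<gamma> * n x\<close> average to
      \<open>1 - \<gamma> * T = tr R\<close>, so the shares of \<open>R\<close> average to
      \<open>R\<close> itself.\<close>
    also have "weighted_sum D (\<lambda>x. mat_inner R G / tr R * (1 - \<gamma> * n x)) = mat_inner R G"
      unfolding weighted_sum_cmult weighted_sum_diff weighted_sum_unit_const[OF D]
      using trR trR_pos by (simp add: T_def)
    finally show "weighted_sum D (\<lambda>x. mat_inner (W x) G) = mat_inner Y G"
      by (simp add: R_inner[OF G])
  next
    have "1 - mat_inner (W x) (outer x) \<le> (1 + \<gamma>) - 2 * \<gamma> * n x" if x: "x \<in> unit_vecs d" for x
    proof -
      note cx = unit_vecsD(1)[OF x]
      have "0 \<le> (1 - \<gamma> * n x) / tr R * mat_inner R (outer x)"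
        using \<gamma>n[OF x] trR_pos psdD[OF R_psd cx] by simp
      moreover have "mat_inner (outer (P x)) (outer x) = (n x)\<^sup>2"
        by (simp add: mat_inner_outer_outer[OF Pc cx] Px[OF cx])
      \<comment> \<open>The tangent to the square at 1 makes the loss affine in \<open>n x\<close>,
        so that its average involves \<open>T\<close> alone.\<close>
      moreover have "\<gamma> * (2 * n x - 1) \<le> \<gamma> * (n x)\<^sup>2"
      proof -
        have "0 \<le> (n x - 1)\<^sup>2" by simp
        then show ?thesis using \<gamma>(1) by (intro mult_left_mono) (auto simp: power2_diff)
      qed
      ultimately show ?thesis by (simp add: W_inner[OF outer_carrier[OF cx]] algebra_simps)
    qed
    then have "weighted_sum D (\<lambda>x. 1 - mat_inner (W x) (outer x)) \<le> weighted_sum D (\<lambda>x. (1 + \<gamma>) - 2 * \<gamma> * n x)"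
      by (intro weighted_sum_mono[OF D])
    also have "\<dots> = (1 - \<gamma>) + \<gamma> * (2 * (1 - T))"
      unfolding weighted_sum_diff weighted_sum_cmult weighted_sum_unit_const[OF D] T_def by (simp add: algebra_simps)
    also have "\<dots> \<le> \<Delta> / \<tau> + 1 * (2 * (1 - T))"
      using \<gamma> T by (intro add_mono mult_right_mono) auto
    \<comment> \<open>\<open>T\<close> is the trace of \<open>PX\<close>, and the trace of
      \<open>PY\<close> is the sum of the eigenvalues in \<open>J\<close>; the difference is
      controlled by the Frobenius norm.\<close>
    also have "1 - T \<le> 1 - (\<Sum>j\<in>J. \<mu> j) + sqrt (card J) * \<Delta>"
    proof -
      have "T = (\<Sum>j\<in>J. weighted_sum D (\<lambda>x. (u j \<bullet> x)\<^sup>2))"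
        unfolding T_def n_def weighted_sum_sum ..
      also have "\<dots> = (\<Sum>j\<in>J. mat_inner X (outer (u j)))"
      proof (rule sum.cong[OF refl])
        fix j assume j: "j \<in> J"
        show "weighted_sum D (\<lambda>x. (u j \<bullet> x)\<^sup>2) = mat_inner X (outer (u j))"
          unfolding X_def mat_inner_mat_of_decomp_weighted_sum[OF cD outer_carrier[OF u[OF j]]]
          using u[OF j] comm_scalar_prod[OF u[OF j]]
          by (intro weighted_sum_cong[OF D]) (simp add: mat_inner_outer_outer[where d=d] unit_vecsD)
      qed
      also have "\<dots> = (\<Sum>j\<in>J. \<mu> j + mat_inner (X - Y) (outer (u j)))"
      proof (rule sum.cong[OF refl])
        fix j assume j: "j \<in> J"
        have "mat_inner Y (outer (u j)) = \<mu> j"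
          using mat_inner_comm[OF YD(1) outer_carrier[OF u[OF j]]] mat_inner_outer[OF u[OF j] YD(1)]
            eigenbasis_eigenvalue[OF e] j J by auto
        then show "mat_inner X (outer (u j)) = \<mu> j + mat_inner (X - Y) (outer (u j))"
          using mat_inner_minus_left[OF sym_matsD(1)[OF XS] YD(1) outer_carrier[OF u[OF j]]] by simp
      qed
      also have "\<dots> = (\<Sum>j\<in>J. \<mu> j) + (\<Sum>j\<in>J. mat_inner (X - Y) (outer (u j)))"
        by (rule sum.distrib)
      finally have "1 - T = 1 - (\<Sum>j\<in>J. \<mu> j) - (\<Sum>j\<in>J. mat_inner (X - Y) (outer (u j)))" by simp
      moreover have "sqrt (card J) * fro_norm (X - Y) \<le> sqrt (card J) * \<Delta>"
        using \<Delta>(2) by (intro mult_left_mono) (simp_all add: X_def)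
      ultimately show ?thesis using sum_eigendirections_le_fro_norm[OF e J XY] by linarith
    qed
    finally show "weighted_sum D (\<lambda>x. 1 - mat_inner (W x) (outer x))
        \<le> \<Delta> / \<tau> + 2 * (1 - (\<Sum>j\<in>J. \<mu> j) + sqrt (card J) * \<Delta>)" by simp
  qed
qed

text \<open>A coupling of the weighted components with \<open>Y\<close>: on average, replacing each
  \<open>x\<close> by its \<open>W x\<close> replaces the iterate by \<open>Y\<close>, while
  \<open>\<delta>\<close> bounds the mean loss of overlap, which is what the rank-one regularizer
  charges.\<close>

definition transportable :: "nat \<Rightarrow> decomposition \<Rightarrow> real mat \<Rightarrow> real \<Rightarrow> bool" where
  "transportable d D Y \<delta> \<longleftrightarrow> (\<exists>W. (\<forall>x\<in>unit_vecs d. W x \<in> spectrahedron d) \<and>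
     (\<forall>G\<in>carrier_mat d d. weighted_sum D (\<lambda>x. mat_inner (W x) G) = mat_inner Y G) \<and>
     weighted_sum D (\<lambda>x. 1 - mat_inner (W x) (outer x)) \<le> \<delta>)"

lemma transportable_one:
  assumes D: "unit_decomp d D" and Y: "Y \<in> spectrahedron d"
  shows "transportable d D Y 1"
proof -
  have "weighted_sum D (\<lambda>x. 1 - mat_inner Y (outer x)) \<le> weighted_sum D (\<lambda>x. 1)"
    using psdD[OF spectrahedronD(3)[OF Y]] by (intro weighted_sum_mono[OF D]) (simp add: unit_vecsD)
  then show ?thesis
    unfolding transportable_def using Y
    by (intro exI[of _ "\<lambda>_. Y"]) (simp add: weighted_sum_unit_const[OF D])
qed

text \<open>\<open>J\<close> keeps the eigenvalues that reach \<open>\<tau>\<close>. At most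
  \<open>r\<close> nonzero ones are dropped, each below \<open>\<tau>\<close>, so the lost trace is
  at most \<open>r * \<tau>\<close>. The threshold stays free, to be balanced against
  \<open>\<Delta>\<close> later.\<close>

lemma transportable_rank:
  assumes D: "unit_decomp d D" and Y: "Y \<in> spectrahedron d" and \<tau>: "0 < \<tau>"
    and \<Delta>: "0 < \<Delta>" "fro_norm (mat_of_decomp d D - Y) \<le> \<Delta>"
    and r: "r = real (vec_space.rank d Y)"
  shows "transportable d D Y (\<Delta> / \<tau> + 2 * (r * \<tau> + sqrt r * \<Delta>))"
proof -
  note YD = spectrahedronD[OF Y]
  obtain u \<mu> where e: "eigenbasis d Y u \<mu>" using spectral_theorem[OF YD(2)] by blast
  define N where "N = {j \<in> {..<d}. \<mu> j \<noteq> 0}"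
  define J where "J = {j \<in> N. \<tau> \<le> \<mu> j}"
  have fin: "finite N" "finite J" by (auto simp: N_def J_def)
  have N: "real (card N) \<le> r"
    using card_nonzero_eigenvalues_le_rank[OF e YD(1)] by (simp add: r N_def)
  have "real (card J) \<le> real (card N)" using card_mono[OF fin(1), of J] by (auto simp: J_def)
  then have J: "sqrt (card J) \<le> sqrt r" using N by simp
  have "1 = (\<Sum>j<d. \<mu> j)" using eigenbasis_tr[OF e YD(1)] YD(4) by simp
  also have "\<dots> = (\<Sum>j\<in>N. \<mu> j)" by (rule sum.mono_neutral_right) (auto simp: N_def)
  also have "\<dots> = (\<Sum>j\<in>N - J. \<mu> j) + (\<Sum>j\<in>J. \<mu> j)"
    by (rule sum.subset_diff) (use fin in \<open>auto simp: J_def\<close>)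
  also have "(\<Sum>j\<in>N - J. \<mu> j) \<le> (\<Sum>j\<in>N - J. \<tau>)" by (intro sum_mono) (auto simp: J_def)
  also have "\<dots> \<le> card N * \<tau>"
    using \<tau> card_mono[OF fin(1), of "N - J"] by (simp add: mult_right_mono)
  also have "\<dots> \<le> r * \<tau>" using N \<tau> by (intro mult_right_mono) auto
  finally have tail: "1 - (\<Sum>j\<in>J. \<mu> j) \<le> r * \<tau>" by simp
  have "sqrt (card J) * \<Delta> \<le> sqrt r * \<Delta>" using J \<Delta>(1) by (intro mult_right_mono) auto
  with tail have *: "\<Delta> / \<tau> + 2 * (1 - (\<Sum>j\<in>J. \<mu> j) + sqrt (card J) * \<Delta>)
      \<le> \<Delta> / \<tau> + 2 * (r * \<tau> + sqrt r * \<Delta>)" by simp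
  show ?thesis
  proof (rule spectrahedron_transport[OF Y e D _ \<tau> _ \<Delta>, of J])
    fix W
    assume "\<And>x. x \<in> unit_vecs d \<Longrightarrow> W x \<in> spectrahedron d"
      "\<And>G. G \<in> carrier_mat d d \<Longrightarrow> weighted_sum D (\<lambda>x. mat_inner (W x) G) = mat_inner Y G"
      "weighted_sum D (\<lambda>x. 1 - mat_inner (W x) (outer x))
        \<le> \<Delta> / \<tau> + 2 * (1 - (\<Sum>j\<in>J. \<mu> j) + sqrt (card J) * \<Delta>)"
    then show ?thesis unfolding transportable_def using * by (intro exI[of _ W]) auto
  qed (auto simp: J_def N_def)
qed

text \<open>With \<open>J\<close> the set of all nonzero eigenvalues no trace is lost. The threshold
  contributes one share of \<open>\<Delta> / l\<close>, the term with \<open>sqrt (card J)\<close>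
  two.\<close>

lemma transportable_eig_min:
  assumes D: "unit_decomp d D" and Y: "Y \<in> spectrahedron d"
    and \<Delta>: "0 < \<Delta>" "fro_norm (mat_of_decomp d D - Y) \<le> \<Delta>"
  shows "transportable d D Y (3 * (\<Delta> / eig_min_nonzero Y))"
proof -
  note YD = spectrahedronD[OF Y]
  define l where "l = eig_min_nonzero Y"
  have l: "0 < l" "l \<le> 1" using eig_min_nonzero_spectrahedron[OF Y] by (auto simp: l_def)
  obtain u \<mu> where e: "eigenbasis d Y u \<mu>" using spectral_theorem[OF YD(2)] by blast
  define J where "J = {j \<in> {..<d}. \<mu> j \<noteq> 0}"
  have "1 = (\<Sum>j<d. \<mu> j)" using eigenbasis_tr[OF e YD(1)] YD(4) by simp
  also have "\<dots> = (\<Sum>j\<in>J. \<mu> j)" by (rule sum.mono_neutral_right) (auto simp: J_def)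
  finally have sum: "(\<Sum>j\<in>J. \<mu> j) = 1" by simp
  have ge: "l \<le> \<mu> j" if "j \<in> J" for j
    using eig_min_nonzero_le[OF e YD(1)] that by (auto simp: J_def l_def)
  have "card J * l \<le> (\<Sum>j\<in>J. \<mu> j)" using sum_mono[of J "\<lambda>_. l" \<mu>] ge by simp
  \<comment> \<open>Trace one gives a count of at most \<open>1 / l\<close>; as
    \<open>l \<le> 1\<close>, it is weakened to the square, whose root matches the term from the
    threshold.\<close>
  then have "card J * l * l \<le> 1 * l" using sum l by (intro mult_right_mono) auto
  then have "card J * l\<^sup>2 \<le> 1" using l unfolding power2_eq_square mult.assoc[symmetric] by linarith
  then have "real (card J) \<le> (1 / l)\<^sup>2" using l by (simp add: field_simps)
  then have "sqrt (card J) \<le> 1 / l" using l by (simp add: real_le_lsqrt)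
  then have "sqrt (card J) * \<Delta> \<le> 1 / l * \<Delta>" using \<Delta>(1) by (intro mult_right_mono) auto
  then have *: "\<Delta> / l + 2 * (1 - (\<Sum>j\<in>J. \<mu> j) + sqrt (card J) * \<Delta>) \<le> 3 * (\<Delta> / l)"
    by (simp add: sum)
  show ?thesis
  proof (rule spectrahedron_transport[OF Y e D _ l(1) ge \<Delta>, of J])
    fix W
    assume "\<And>x. x \<in> unit_vecs d \<Longrightarrow> W x \<in> spectrahedron d"
      "\<And>G. G \<in> carrier_mat d d \<Longrightarrow> weighted_sum D (\<lambda>x. mat_inner (W x) G) = mat_inner Y G"
      "weighted_sum D (\<lambda>x. 1 - mat_inner (W x) (outer x))
        \<le> \<Delta> / l + 2 * (1 - (\<Sum>j\<in>J. \<mu> j) + sqrt (card J) * \<Delta>)"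
    then show ?thesis unfolding transportable_def using * by (intro exI[of _ W]) (auto simp: l_def)
  qed (auto simp: J_def)
qed

subsection \<open>The law of the sampled indices\<close>

text \<open>Puts averages into the form of \<open>expectation_index_pmf\<close>, the expectation
  over the drawn index.\<close>

lemma weighted_sum_nth: "weighted_sum D F = (\<Sum>i<length D. fst (D ! i) * F (snd (D ! i)))"
  unfolding weighted_sum_def by (simp add: sum_list_sum_nth case_prod_unfold atLeast0LessThan)

lemma expectation_index_pmf:
  fixes F :: "nat \<Rightarrow> real"
  assumes wf: "pmf_of_list_wf (zip [0..<length D] (map fst D))"
  shows "measure_pmf.expectation (index_pmf D) F = (\<Sum>i<length D. fst (D ! i) * F i)"
proof -
  have pmf: "pmf (index_pmf D) i = fst (D ! i)" if "i < length D" for i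
  proof -
    have "pmf (index_pmf D) i = sum_list (map (\<lambda>z. if fst z = i then snd z else 0) (zip [0..<length D] (map fst D)))"
      unfolding index_pmf_def pmf_pmf_of_list[OF wf] by (simp add: sum_list_map_filter')
    also have "\<dots> = (\<Sum>j<length D. if j = i then fst (D ! j) else 0)"
      by (simp add: sum_list_sum_nth atLeast0LessThan)
    also have "\<dots> = fst (D ! i)" using that by simp
    finally show ?thesis .
  qed
  have "set_pmf (index_pmf D) \<subseteq> {..<length D}"
    using set_pmf_of_list[OF wf] by (auto simp: index_pmf_def dest!: set_zip_leftD)
  then have "measure_pmf.expectation (index_pmf D) F = (\<Sum>i<length D. pmf (index_pmf D) i *\<^sub>R F i)"
    by (intro integral_measure_pmf) auto
  also have "\<dots> = (\<Sum>i<length D. fst (D ! i) * F i)" by (intro sum.cong refl) (simp add: pmf)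
  finally show ?thesis .
qed

text \<open>Positive weights put every index into the support, so the assumption on the oracle
  covers each component of a reachable decomposition.\<close>

lemma set_index_pmf:
  assumes "pmf_of_list_wf (zip [0..<length D] (map fst D))" "\<forall>p\<in>set D. fst p > 0"
  shows "set_pmf (index_pmf D) = {..<length D}"
proof -
  have "set_pmf (pmf_of_list (zip [0..<length D] (map fst D))) = fst ` set (zip [0..<length D] (map fst D))"
    using assms by (intro set_pmf_of_list_eq) (auto dest!: set_zip_rightD)
  also have "\<dots> = set (map fst (zip [0..<length D] (map fst D)))" by (simp only: set_map)
  also have "map fst (zip [0..<length D] (map fst D)) = [0..<length D]" by (rule map_fst_zip) simp
  finally show ?thesis by (simp add: index_pmf_def atLeast0LessThan)
qed

text \<open>The step sizes of the theorem. At \<open>t = 1\<close> the value is 2, so the initial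
  weight 1 equals \<open>eta 1 / 2\<close> and starts the invariant on the weights.\<close>

definition eta :: "nat \<Rightarrow> real" where
  "eta t = 18 / (real t + 8)"

lemma eta_pos: "eta t > 0"
  by (simp add: eta_def add_nonneg_pos)

lemma eta_antimono: "s \<le> t \<Longrightarrow> eta t \<le> eta s"
  unfolding eta_def by (intro divide_left_mono mult_pos_pos) auto

lemmas decomp_weights_eta = decomp_weights[of eta, OF eta_pos]

text \<open>Finite support reduces expectations to finite sums and makes every real function of the
  history integrable.\<close>

lemma finite_draws: "finite (set_pmf (draws eta ev n))"
proof (induction n)
  case (Suc n)
  have "finite (set_pmf (index_pmf (decomp eta ev h)))" if "h \<in> set_pmf (draws eta ev n)" for h
    using decomp_weights_eta[OF that] set_index_pmf by auto
  then show ?case using Suc by simp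
qed simp

lemma expectation_draws_Suc:
  fixes F :: "history \<Rightarrow> real"
  shows "measure_pmf.expectation (draws eta ev (Suc n)) F =
    measure_pmf.expectation (draws eta ev n) (\<lambda>h. \<Sum>i<length (decomp eta ev h). fst (decomp eta ev h ! i) * F (i # h))"
proof -
  have fin: "finite (set_pmf (index_pmf (decomp eta ev h)))" if "h \<in> set_pmf (draws eta ev n)" for h
    using decomp_weights_eta[OF that] set_index_pmf by auto
  have "measure_pmf.expectation (draws eta ev (Suc n)) F =
    (\<Sum>h\<in>set_pmf (draws eta ev n). pmf (draws eta ev n) h *\<^sub>R
      measure_pmf.expectation (map_pmf (\<lambda>i. i # h) (index_pmf (decomp eta ev h))) F)"
    unfolding draws.simps by (intro pmf_expectation_bind) (auto simp: finite_draws fin)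
  also have "\<dots> = (\<Sum>h\<in>set_pmf (draws eta ev n). pmf (draws eta ev n) h *\<^sub>R
      (\<Sum>i<length (decomp eta ev h). fst (decomp eta ev h ! i) * F (i # h)))"
    using decomp_weights_eta by (intro sum.cong refl) (simp add: expectation_index_pmf)
  also have "\<dots> = measure_pmf.expectation (draws eta ev n)
      (\<lambda>h. \<Sum>i<length (decomp eta ev h). fst (decomp eta ev h ! i) * F (i # h))"
    by (intro integral_measure_pmf[symmetric]) (auto simp: finite_draws)
  finally show ?thesis .
qed

lemma expectation_draws_mono:
  fixes F G :: "history \<Rightarrow> real"
  assumes "\<And>h. h \<in> set_pmf (draws eta ev n) \<Longrightarrow> F h \<le> G h"
  shows "measure_pmf.expectation (draws eta ev n) F \<le> measure_pmf.expectation (draws eta ev n) G"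
  using assms finite_draws
  by (intro integral_mono_AE integrable_measure_pmf_finite) (auto simp: AE_measure_pmf_iff)

lemma expectation_draws_affine:
  fixes F :: "history \<Rightarrow> real"
  shows "measure_pmf.expectation (draws eta ev n) (\<lambda>h. a * F h + b)
    = a * measure_pmf.expectation (draws eta ev n) F + b"
  by (subst Bochner_Integration.integral_add)
    (auto intro!: integrable_measure_pmf_finite simp: finite_draws)

subsection \<open>One step of the algorithm\<close>

text \<open>The tolerances from round 1 on are only positive here; their upper bounds enter
  separately with each rate.\<close>

locale rrcg =
  fixes d :: nat and f :: "real mat \<Rightarrow> real" and g :: "real mat \<Rightarrow> real mat" and \<alpha> \<beta> :: real
    and Xs :: "real mat" and \<xi> :: "nat \<Rightarrow> real" and x\<^sub>0 :: "real vec" and ev :: "history \<Rightarrow> real vec"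
  assumes \<alpha>: "0 < \<alpha>" and \<alpha>\<beta>: "\<alpha> \<le> \<beta>"
    and grad: "is_gradient d f g" and convex: "strongly_convex d \<alpha> f g" and smooth: "smooth d \<beta> f g"
    and opt: "is_arg_min f (\<lambda>X. X \<in> spectrahedron d) Xs"
    and \<xi>0: "\<xi> 0 = \<beta>" and \<xi>: "\<And>t. t \<ge> 1 \<Longrightarrow> 0 < \<xi> t"
    and run: "RRCG_run d g \<beta> eta \<xi> x\<^sub>0 ev"
begin

abbreviation dec :: "history \<Rightarrow> decomposition" where
  "dec \<equiv> decomp eta ev"

abbreviation X :: "history \<Rightarrow> real mat" where
  "X \<equiv> iterate d eta ev"

definition gap :: "real mat \<Rightarrow> real" where
  "gap Y = f Y - f Xs"

lemma Xs: "Xs \<in> spectrahedron d"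
  using opt by (simp add: is_arg_min_def)

lemma gap_nonneg: "Y \<in> spectrahedron d \<Longrightarrow> 0 \<le> gap Y"
  using opt by (auto simp: is_arg_min_def gap_def not_less)

lemma \<beta>: "0 < \<beta>"
  using \<alpha> \<alpha>\<beta> by simp

lemma grad_sym: "Y \<in> sym_mats d \<Longrightarrow> g Y \<in> sym_mats d"
  using grad by (simp add: is_gradient_def has_gradient_def)

lemma convexD:
  assumes Y: "Y \<in> sym_mats d" and Z: "Z \<in> sym_mats d"
  shows "f Y + (mat_inner Z (g Y) - mat_inner Y (g Y)) + \<alpha> / 2 * (fro_norm (Y - Z))\<^sup>2 \<le> f Z"
  using bspec[OF bspec[OF convex[unfolded strongly_convex_def] Y] Z]
    mat_inner_minus_left[OF sym_matsD(1)[OF Z] sym_matsD(1)[OF Y] sym_matsD(1)[OF grad_sym[OF Y]]]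
  by simp

lemma smoothD:
  assumes Y: "Y \<in> sym_mats d" and Z: "Z \<in> sym_mats d"
  shows "f Z \<le> f Y + (mat_inner Z (g Y) - mat_inner Y (g Y)) + \<beta> / 2 * (fro_norm (Y - Z))\<^sup>2"
  using bspec[OF bspec[OF smooth[unfolded smooth_def] Y] Z]
    mat_inner_minus_left[OF sym_matsD(1)[OF Z] sym_matsD(1)[OF Y] sym_matsD(1)[OF grad_sym[OF Y]]]
  by simp

lemma convex_gap:
  assumes Y: "Y \<in> sym_mats d"
  shows "mat_inner Xs (g Y) - mat_inner Y (g Y) \<le> - gap Y"
proof -
  have "0 \<le> \<alpha> / 2 * (fro_norm (Y - Xs))\<^sup>2" using \<alpha> by simp
  then show ?thesis using convexD[OF Y spectrahedronD(2)[OF Xs]] by (simp add: gap_def)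
qed

text \<open>Comparing \<open>f\<close> at the midpoint of \<open>Y\<close> and the minimizer avoids the first-order optimality condition.\<close>

lemma quadratic_growth:
  assumes Y: "Y \<in> spectrahedron d"
  shows "\<alpha> * (fro_norm (Y - Xs))\<^sup>2 \<le> 4 * gap Y"
proof -
  note YD = spectrahedronD[OF Y] and XD = spectrahedronD[OF Xs]
  define M where "M = (1/2) \<cdot>\<^sub>m Y + (1/2) \<cdot>\<^sub>m Xs"
  have M: "M \<in> spectrahedron d"
    unfolding spectrahedron_def M_def
    using psd_combination[OF YD(3) XD(3), of "1/2" "1/2"] tr_combination[OF YD(1) XD(1), of "1/2" "1/2"] YD(4) XD(4)
    by (simp add: psd_def)
  note MD = spectrahedronD[OF M]
  note G = sym_matsD(1)[OF grad_sym[OF MD(2)]]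
  have dist: "(fro_norm (M - Z))\<^sup>2 = (fro_norm (Y - Xs))\<^sup>2 / 4" if "Z = Y \<or> Z = Xs" for Z
  proof -
    obtain s where s: "s\<^sup>2 = 1/4" "M - Z = s \<cdot>\<^sub>m (Y - Xs)"
    proof (cases "Z = Y")
      case True
      have "M - Z = (- 1/2) \<cdot>\<^sub>m (Y - Xs)"
        using YD(1) XD(1) True by (intro eq_matI) (auto simp: M_def diff_divide_distrib)
      then show ?thesis using that[of "- 1/2"] by (simp add: power2_eq_square)
    next
      case False
      then have "M - Z = (1/2) \<cdot>\<^sub>m (Y - Xs)"
        using YD(1) XD(1) \<open>Z = Y \<or> Z = Xs\<close> by (intro eq_matI) (auto simp: M_def)
      then show ?thesis using that[of "1/2"] by (simp add: power2_eq_square)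
    qed
    note S = sym_mats_minus[OF YD(2) XD(2)]
    have "(fro_norm (s \<cdot>\<^sub>m (Y - Xs)))\<^sup>2 = s\<^sup>2 * (fro_norm (Y - Xs))\<^sup>2"
      unfolding fro_norm_sq[OF S] fro_norm_sq[OF sym_mats_smult[OF S]]
      using sym_matsD(1)[OF S]
      by (simp add: mat_inner_smult_left[where d=d] mat_inner_smult_right[where d=d] power2_eq_square)
    then show ?thesis using s by simp
  qed
  have "mat_inner M (g M) = 1/2 * mat_inner Y (g M) + 1/2 * mat_inner Xs (g M)"
    using YD(1) XD(1) G
    by (subst (1) M_def) (simp add: mat_inner_add_left[where d=d] mat_inner_smult_left[where d=d])
  moreover have "f M + (mat_inner Y (g M) - mat_inner M (g M)) + \<alpha> / 2 * ((fro_norm (Y - Xs))\<^sup>2 / 4) \<le> f Y"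
    using convexD[OF MD(2) YD(2)] dist by simp
  moreover have "f M + (mat_inner Xs (g M) - mat_inner M (g M)) + \<alpha> / 2 * ((fro_norm (Y - Xs))\<^sup>2 / 4) \<le> f Xs"
    using convexD[OF MD(2) XD(2)] dist by simp
  \<comment> \<open>In the sum of the two inequalities the gradient terms cancel, \<open>M\<close>
    being the midpoint. What remains is \<open>\<alpha> / 4\<close> times the squared distance,
    bounded by \<open>gap Y - 2 * gap M\<close>.\<close>
  ultimately show ?thesis using gap_nonneg[OF M] by (simp add: gap_def field_simps)
qed

text \<open>The lower bound on the weights makes \<open>\<eta>\<^sub>t/2\<close> a lower bound for the moved mass.\<close>

lemma dec_invariant:
  assumes "h \<in> set_pmf (draws eta ev n)"
  shows "unit_decomp d (dec h) \<and> (\<forall>p\<in>set (dec h). eta (n + 1) / 2 \<le> fst p)"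
proof -
  have "(\<forall>p\<in>set (dec h). snd p \<in> unit_vecs d) \<and> (\<forall>p\<in>set (dec h). eta (n + 1) / 2 \<le> fst p)"
    using assms
  proof (induction n arbitrary: h)
    case 0
    then show ?case using run by (auto simp: RRCG_run_def approx_EV_def eta_def)
  next
    case (Suc n)
    then obtain i k where h: "h = i # k" and k: "k \<in> set_pmf (draws eta ev n)"
      and i: "i \<in> set_pmf (index_pmf (dec k))" by auto
    note w = decomp_weights_eta[OF k]
    have len: "i < length (dec k)" using i set_index_pmf w by auto
    note IH = Suc.IH[OF k]
    let ?a = "fst (dec k ! i)"
    let ?m = "step_mass (eta (n + 1)) ?a"
    have "\<forall>h\<in>set_pmf (past eta ev (n + 1)). \<forall>i\<in>set_pmf (index_pmf (dec h)).
        ev (i # h) \<in> approx_EV d (\<xi> (n + 1))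
          (- g (X h) + (eta (n + 1) * \<beta>) \<cdot>\<^sub>m outer (snd (dec h ! i)))"
      using run unfolding RRCG_run_def by simp
    then have v: "ev (i # k) \<in> unit_vecs d"
      using i k by (auto simp: past_def approx_EV_def)
    have a: "eta (n + 1) / 2 \<le> ?a" using IH len by simp
    have m: "eta (n + 1) / 2 \<le> ?m" using a by (simp add: step_mass_def)
    have le: "eta (Suc n + 1) / 2 \<le> eta (n + 1) / 2" using eta_antimono[of "n + 1" "Suc n + 1"] by simp
    have dh: "dec h = move_mass ?m i (ev (i # k)) (dec k)"
      using w by (simp add: h Let_def)
    have "snd p \<in> unit_vecs d \<and> eta (n + 1) / 2 \<le> fst p" if p: "p \<in> set (dec h)" for p
    proof (cases "?a - ?m = 0")
      case True
      then have "p \<in> insert (?m, ev (i # k)) (set (dec k))"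
        using p set_take_subset[of i "dec k"] set_drop_subset[of "Suc i" "dec k"]
        unfolding dh move_mass_def by auto
      then show ?thesis using IH m v by auto
    next
      case False
      \<comment> \<open>A nonzero remainder arises only from a weight of at least
        \<open>eta (n + 1)\<close>, of which \<open>eta (n + 1) / 2\<close> is moved.\<close>
      then have "eta (n + 1) / 2 \<le> ?a - ?m" by (auto simp: step_mass_def split: if_splits)
      then show ?thesis
        using p subsetD[OF set_move_mass, of p ?m i "ev (i # k)" "dec k"] IH m v len
        unfolding dh by auto
    qed
    then show ?case using le by fastforce
  qed
  then show ?thesis
    using decomp_weights_eta[OF assms] by (fastforce simp: unit_decomp_def)
qed

lemma X_in_spectrahedron: "h \<in> set_pmf (draws eta ev n) \<Longrightarrow> X h \<in> spectrahedron d"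
  using dec_invariant mat_of_decomp_in_spectrahedron by (simp add: iterate_def)

text \<open>Smoothness bounds the change of \<open>f\<close> by the moved mass \<open>m\<close>
  times \<open>\<phi> (outer v)\<close>, and the oracle nearly minimizes \<open>\<phi>\<close> over
  the spectrahedron. Since \<open>m\<close> is only known to lie between \<open>eta t / 2\<close>
  and \<open>eta t\<close>, the sign of \<open>\<phi> W\<close> decides how \<open>m\<close> is
  eliminated.\<close>

lemma step_descent:
  assumes h: "h \<in> set_pmf (draws eta ev n)" and i: "i < length (dec h)" and W: "W \<in> spectrahedron d"
  defines "x \<equiv> snd (dec h ! i)" and "t \<equiv> n + 1"
  shows "gap (X (i # h)) \<le> gap (X h) + eta t / 2 * (mat_inner W (g (X h)) - mat_inner (outer x) (g (X h))
      + eta t * \<beta> * (1 - mat_inner W (outer x))) + eta t * \<xi> t"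
proof -
  note w = decomp_weights_eta[OF h] and inv = dec_invariant[OF h]
  define m where "m = step_mass (eta t) (fst (dec h ! i))"
  define v where "v = ev (i # h)"
  define G where "G = g (X h)"
  define L where "L = - G + (eta t * \<beta>) \<cdot>\<^sub>m outer x"
  define \<phi> where "\<phi> W = mat_inner W G - mat_inner (outer x) G + eta t * \<beta> * (1 - mat_inner W (outer x))" for W
  have "set_pmf (index_pmf (dec h)) = {..<length (dec h)}" using set_index_pmf w by auto
  then have vL: "v \<in> approx_EV d (\<xi> t) L"
    using run h i unfolding RRCG_run_def t_def past_def v_def L_def G_def x_def
    by (metis add_diff_cancel_right' le_add2 lessThan_iff)
  then have v: "v \<in> unit_vecs d" by (simp add: approx_EV_def)
  have mem: "dec h ! i \<in> set (dec h)" using i by simp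
  then have x: "x \<in> unit_vecs d" using inv unfolding unit_decomp_def x_def by (auto simp: case_prod_unfold)
  note cv = unit_vecsD(1)[OF v] and cx = unit_vecsD(1)[OF x]
  have m: "eta t / 2 \<le> m" "m \<le> eta t"
    using inv mem eta_pos[of t] by (auto simp: m_def step_mass_def t_def)
  have m0: "0 < m" using m(1) eta_pos[of t] by simp
  note XD = spectrahedronD[OF X_in_spectrahedron[OF h]]
  have GS: "G \<in> sym_mats d" unfolding G_def by (rule grad_sym[OF XD(2)])
  note cG = sym_matsD(1)[OF GS]
  have LS: "L \<in> sym_mats d"
    unfolding L_def by (intro sym_mats_add sym_mats_uminus sym_mats_smult outer_sym GS cx)
  have L: "mat_inner Z L = - mat_inner Z G + eta t * \<beta> * mat_inner Z (outer x)" if "Z \<in> carrier_mat d d" for Z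
    unfolding L_def using that cG cx
    by (simp add: mat_inner_add_right[where d=d] mat_inner_uminus_right[where d=d] mat_inner_smult_right[where d=d])
  have ev_ge: "mat_inner Z L - \<xi> t \<le> mat_inner (outer v) L" if Z: "Z \<in> spectrahedron d" for Z
  proof -
    have "mat_inner Z L \<le> eig_max L"
      using mat_inner_psd_le_eig_max[OF spectrahedronD(3)[OF Z] LS] spectrahedronD(4)[OF Z] by simp
    then show ?thesis using vL mat_inner_outer[OF cv sym_matsD(1)[OF LS]] by (simp add: approx_EV_def)
  qed
  have \<phi>v: "\<phi> (outer v) \<le> \<phi> Z + \<xi> t" if Z: "Z \<in> spectrahedron d" for Z
    using ev_ge[OF Z] L[OF spectrahedronD(1)[OF Z]] L[OF outer_carrier[OF cv]]
    by (simp add: \<phi>_def algebra_simps)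
  define S where "S = outer v - outer x"
  have SS: "S \<in> sym_mats d" unfolding S_def by (intro sym_mats_minus outer_sym cv cx)
  have X': "X (i # h) = X h + m \<cdot>\<^sub>m S"
    using mat_of_decomp_move_mass[OF unit_decomp_carrier[OF conjunct1[OF inv]] cv i] w
    by (simp add: iterate_def Let_def m_def v_def t_def S_def x_def)
  have X'S: "X (i # h) \<in> sym_mats d"
    unfolding X' by (intro sym_mats_add sym_mats_smult XD SS)
  have "X h - X (i # h) = (- m) \<cdot>\<^sub>m S"
    unfolding X' using XD(1) sym_matsD(1)[OF SS] by (intro eq_matI) auto
  then have "(fro_norm (X h - X (i # h)))\<^sup>2 = mat_inner ((- m) \<cdot>\<^sub>m S) ((- m) \<cdot>\<^sub>m S)"
    by (simp only: fro_norm_sq[OF sym_mats_smult[OF SS]])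
  also have "\<dots> = m\<^sup>2 * mat_inner S S"
    using sym_matsD(1)[OF SS]
    by (simp add: mat_inner_smult_left[where d=d] mat_inner_smult_right[where d=d] power2_eq_square)
  \<comment> \<open>For unit vectors the squared distance of the two rank-one matrices is affine in
    their overlap, so the quadratic term of smoothness takes the shape of the regularizer.\<close>
  also have "mat_inner S S = 2 * (1 - mat_inner (outer v) (outer x))"
  proof -
    have SZ: "mat_inner S Z = mat_inner (outer v) Z - mat_inner (outer x) Z" if "Z \<in> carrier_mat d d" for Z
      unfolding S_def using that cv cx by (simp add: mat_inner_minus_left[where d=d])
    have "mat_inner S S = mat_inner (outer v) S - mat_inner (outer x) S" by (rule SZ[OF sym_matsD(1)[OF SS]])
    also have "\<dots> = mat_inner S (outer v) - mat_inner S (outer x)"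
      using mat_inner_comm[OF sym_matsD(1)[OF SS]] cv cx by simp
    finally show ?thesis
      using cv cx mat_inner_comm[OF outer_carrier[OF cv] outer_carrier[OF cx]]
      by (simp add: SZ mat_inner_outer_outer[where d=d] unit_vecsD(2)[OF v] unit_vecsD(2)[OF x])
  qed
  finally have norm: "(fro_norm (X h - X (i # h)))\<^sup>2 = m\<^sup>2 * (2 * (1 - mat_inner (outer v) (outer x)))" .
  have ov: "0 \<le> 1 - mat_inner (outer v) (outer x)"
    using mat_inner_le_fro_norm[OF outer_sym[OF cv] outer_sym[OF cx]]
    by (simp add: fro_norm_outer[OF cv] fro_norm_outer[OF cx] unit_vecsD(2)[OF v] unit_vecsD(2)[OF x])
  have "f (X (i # h)) \<le> f (X h) + m * (mat_inner (outer v) G - mat_inner (outer x) G)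
      + m * (m * \<beta> * (1 - mat_inner (outer v) (outer x)))"
  proof -
    have "mat_inner (X (i # h)) G - mat_inner (X h) G = m * (mat_inner (outer v) G - mat_inner (outer x) G)"
      unfolding X' S_def using XD(1) cG cv cx
      by (simp add: mat_inner_add_left[where d=d] mat_inner_smult_left[where d=d]
          mat_inner_minus_left[where d=d] minus_carrier_mat)
    moreover have "\<beta> / 2 * (fro_norm (X h - X (i # h)))\<^sup>2
        = m * (m * \<beta> * (1 - mat_inner (outer v) (outer x)))"
      unfolding norm by (simp add: power2_eq_square)
    ultimately show ?thesis using smoothD[OF XD(2) X'S] unfolding G_def by linarith
  qed
  \<comment> \<open>Enlarging \<open>m\<close> to \<open>eta t\<close> matches the coefficient of
    the regularizer in the oracle query.\<close>
  also have "m * \<beta> * (1 - mat_inner (outer v) (outer x)) \<le> eta t * \<beta> * (1 - mat_inner (outer v) (outer x))"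
    using m(2) \<beta> ov by (intro mult_right_mono) auto
  finally have *: "f (X (i # h)) \<le> f (X h) + m * \<phi> (outer v)"
    using m0 by (simp add: \<phi>_def algebra_simps)
  have \<xi>t: "m * \<xi> t \<le> eta t * \<xi> t" using m(2) \<xi>[of t] by (intro mult_right_mono) (auto simp: t_def)
  have "m * \<phi> (outer v) \<le> eta t / 2 * \<phi> W + eta t * \<xi> t"
  proof (cases "\<phi> W \<le> 0")
    case True
    have "m * \<phi> (outer v) \<le> m * (\<phi> W + \<xi> t)" using \<phi>v[OF W] m0 by simp
    also have "\<dots> = m * \<phi> W + m * \<xi> t" by (simp add: algebra_simps)
    also have "m * \<phi> W \<le> eta t / 2 * \<phi> W" using True m(1) by (rule mult_right_mono_neg[rotated])
    finally show ?thesis using \<xi>t by simp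
  next
    case False
    \<comment> \<open>If \<open>W\<close> promises no descent, the oracle is compared with
      \<open>outer x\<close> itself: putting the mass back costs at most the tolerance.\<close>
    have "\<phi> (outer x) = 0"
      using cx by (simp add: \<phi>_def mat_inner_outer_outer[where d=d] unit_vecsD(2)[OF x])
    then have "m * \<phi> (outer v) \<le> m * \<xi> t" using \<phi>v[OF outer_in_spectrahedron[OF x]] m0 by simp
    moreover have "0 \<le> eta t / 2 * \<phi> W" using False eta_pos[of t] by simp
    ultimately show ?thesis using \<xi>t by simp
  qed
  with * show ?thesis by (simp add: \<phi>_def G_def gap_def)
qed

text \<open>\<open>step_descent\<close> is averaged with a comparison matrix that depends on the
  drawn component. The gradient terms average to the inner product of the gradient with
  \<open>Xs - X h\<close>, at most \<open>- gap (X h)\<close> by convexity.\<close>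

lemma expected_descent:
  assumes h: "h \<in> set_pmf (draws eta ev n)" and tp: "transportable d (dec h) Xs \<delta>"
  defines "t \<equiv> n + 1"
  shows "(\<Sum>i<length (dec h). fst (dec h ! i) * gap (X (i # h)))
    \<le> (1 - eta t / 2) * gap (X h) + (eta t)\<^sup>2 * \<beta> / 2 * \<delta> + eta t * \<xi> t"
proof -
  let ?D = "dec h" and ?G = "g (X h)"
  have D: "unit_decomp d ?D" and inv: "\<forall>p\<in>set ?D. eta (n + 1) / 2 \<le> fst p"
    using dec_invariant[OF h] by auto
  note XD = spectrahedronD[OF X_in_spectrahedron[OF h]]
  note cG = sym_matsD(1)[OF grad_sym[OF XD(2)]]
  have X_inner: "weighted_sum ?D (\<lambda>x. mat_inner (outer x) ?G) = mat_inner (X h) ?G"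
    using mat_inner_mat_of_decomp_weighted_sum[OF unit_decomp_carrier[OF D] cG] by (simp add: iterate_def)
  obtain W where W: "\<And>x. x \<in> unit_vecs d \<Longrightarrow> W x \<in> spectrahedron d"
    "\<And>G. G \<in> carrier_mat d d \<Longrightarrow> weighted_sum ?D (\<lambda>x. mat_inner (W x) G) = mat_inner Xs G"
    "weighted_sum ?D (\<lambda>x. 1 - mat_inner (W x) (outer x)) \<le> \<delta>"
    using tp unfolding transportable_def by blast
  define F where "F = (\<lambda>x. (gap (X h) + eta t * \<xi> t) + eta t / 2 * ((mat_inner (W x) ?G - mat_inner (outer x) ?G)
        + eta t * \<beta> * (1 - mat_inner (W x) (outer x))))"
  have "(\<Sum>i<length ?D. fst (?D ! i) * gap (X (i # h))) \<le> (\<Sum>i<length ?D. fst (?D ! i) * F (snd (?D ! i)))"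
  proof (intro sum_mono mult_left_mono)
    fix i assume "i \<in> {..<length ?D}"
    then have i: "i < length ?D" by simp
    have "?D ! i \<in> set ?D" using i by simp
    then show "0 \<le> fst (?D ! i)" using inv eta_pos[of "n + 1"] by (meson half_gt_zero less_le_not_le order_trans linear)
    have "snd (?D ! i) \<in> unit_vecs d"
      using D \<open>?D ! i \<in> set ?D\<close> by (auto simp: unit_decomp_def case_prod_unfold)
    from step_descent[OF h i W(1)[OF this]]
    show "gap (X (i # h)) \<le> F (snd (?D ! i))"
      by (simp add: F_def t_def algebra_simps)
  qed
  also have "\<dots> = (gap (X h) + eta t * \<xi> t) + eta t / 2 * ((mat_inner Xs ?G - mat_inner (X h) ?G)
        + eta t * \<beta> * weighted_sum ?D (\<lambda>x. 1 - mat_inner (W x) (outer x)))"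
    unfolding weighted_sum_nth[of ?D F, symmetric]
    unfolding F_def weighted_sum_add weighted_sum_cmult[of _ "eta t / 2"] weighted_sum_cmult[of _ "eta t * \<beta>"]
      weighted_sum_unit_const[OF D] weighted_sum_diff[of _ "\<lambda>x. mat_inner (W x) ?G"] W(2)[OF cG] X_inner ..
  also have "\<dots> \<le> (gap (X h) + eta t * \<xi> t) + eta t / 2 * (- gap (X h) + eta t * \<beta> * \<delta>)"
    using convex_gap[OF XD(2)] W(3) eta_pos[of t] \<beta>
    by (intro add_left_mono mult_left_mono add_mono) auto
  also have "\<dots> = (1 - eta t / 2) * gap (X h) + (eta t)\<^sup>2 * \<beta> / 2 * \<delta> + eta t * \<xi> t"
    by (simp add: field_simps power2_eq_square)
  finally show ?thesis .
qed

section \<open>Recursion for the expected error\<close>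

definition err :: "nat \<Rightarrow> real" where
  "err t = measure_pmf.expectation (past eta ev t) (\<lambda>h. gap (X h))"

text \<open>The transport cost varies with the history, but its bound is affine in the gap, so
  taking expectations just replaces the gap by \<open>err t\<close>.\<close>

lemma err_Suc:
  assumes t: "t \<ge> 1"
    and tp: "\<And>h. h \<in> set_pmf (past eta ev t) \<Longrightarrow> transportable d (dec h) Xs (a * gap (X h) + b)"
  shows "err (Suc t) \<le> (1 - eta t / 2) * err t + (eta t)\<^sup>2 * \<beta> / 2 * (a * err t + b) + eta t * \<xi> t"
proof -
  obtain n where n: "t = n + 1" using t by (metis le_add_diff_inverse2)
  let ?E = "measure_pmf.expectation (draws eta ev n)"
  let ?c = "(1 - eta t / 2) + (eta t)\<^sup>2 * \<beta> / 2 * a" and ?e = "(eta t)\<^sup>2 * \<beta> / 2 * b + eta t * \<xi> t"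
  have "err (Suc t) = ?E (\<lambda>h. \<Sum>i<length (dec h). fst (dec h ! i) * gap (X (i # h)))"
    unfolding err_def past_def n using expectation_draws_Suc by simp
  also have "\<dots> \<le> ?E (\<lambda>h. ?c * gap (X h) + ?e)"
  proof (rule expectation_draws_mono)
    fix h assume h: "h \<in> set_pmf (draws eta ev n)"
    then have "transportable d (dec h) Xs (a * gap (X h) + b)" by (intro tp) (simp add: past_def n)
    from expected_descent[OF h this]
    show "(\<Sum>i<length (dec h). fst (dec h ! i) * gap (X (i # h))) \<le> ?c * gap (X h) + ?e"
      by (simp add: n algebra_simps add_divide_distrib)
  qed
  also have "\<dots> = ?c * err t + ?e"
    unfolding expectation_draws_affine err_def past_def n by simp
  finally show ?thesis by (simp add: algebra_simps add_divide_distrib)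
qed

lemma err_nonneg: "0 \<le> err t"
  unfolding err_def past_def
  using expectation_draws_mono[of ev "t - 1" "\<lambda>_. 0" "\<lambda>h. gap (X h)"] gap_nonneg[OF X_in_spectrahedron]
  by simp

text \<open>By convexity the linearization at \<open>outer x\<^sub>0\<close> is at most
  \<open>f Xs\<close> at the minimizer. The first oracle call loses \<open>\<xi> 0 = \<beta>\<close>
  against it, and smoothness adds \<open>\<beta> / 2\<close> times a squared distance of at most
  2.\<close>

lemma err_1: "err 1 \<le> 2 * \<beta>"
proof -
  have x0: "x\<^sub>0 \<in> unit_vecs d" and v: "ev [] \<in> approx_EV d \<beta> (- g (outer x\<^sub>0))"
    using run \<xi>0 by (auto simp: RRCG_run_def)
  then have x1: "ev [] \<in> unit_vecs d" by (simp add: approx_EV_def)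
  let ?A = "outer x\<^sub>0" and ?B = "outer (ev [])"
  note c0 = unit_vecsD(1)[OF x0] and c1 = unit_vecsD(1)[OF x1]
  have GS: "g ?A \<in> sym_mats d" by (rule grad_sym[OF outer_sym[OF c0]])
  note cG = sym_matsD(1)[OF GS] and XsD = spectrahedronD[OF Xs]
  have "mat_inner Xs (- g ?A) \<le> eig_max (- g ?A)"
    using mat_inner_psd_le_eig_max[OF XsD(3) sym_mats_uminus[OF GS]] XsD(4) by simp
  also have "\<dots> \<le> mat_inner ?B (- g ?A) + \<beta>"
    using v cG by (simp add: approx_EV_def mat_inner_outer[OF c1])
  finally have 1: "mat_inner ?B (g ?A) \<le> mat_inner Xs (g ?A) + \<beta>"
    using cG XsD(1) c1 by (simp add: mat_inner_uminus_right[where d=d])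
  have S: "?A - ?B \<in> sym_mats d" by (intro sym_mats_minus outer_sym c0 c1)
  have "(fro_norm (?A - ?B))\<^sup>2 = mat_inner (?A - ?B) ?A - mat_inner (?A - ?B) ?B"
    unfolding fro_norm_sq[OF S]
    using mat_inner_minus_left[OF outer_carrier[OF c0] outer_carrier[OF c1] sym_matsD(1)[OF S]]
      mat_inner_comm[OF sym_matsD(1)[OF S]] c0 c1 by simp
  also have "\<dots> = 2 - 2 * mat_inner ?A ?B"
    using c0 c1 mat_inner_comm[OF outer_carrier[OF c0] outer_carrier[OF c1]]
      mat_inner_outer_outer[OF c0 c0] mat_inner_outer_outer[OF c1 c1] unit_vecsD(2)[OF x0] unit_vecsD(2)[OF x1]
    by (simp add: mat_inner_minus_left[where d=d])
  also have "\<dots> \<le> 2" using mat_inner_outer_outer[OF c0 c1] by simp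
  finally have 2: "\<beta> / 2 * (fro_norm (?A - ?B))\<^sup>2 \<le> \<beta> / 2 * 2" using \<beta> by (intro mult_left_mono) auto
  have "f ?B \<le> f Xs + 2 * \<beta>"
    using smoothD[OF outer_sym[OF c0] outer_sym[OF c1]] 1 2 convex_gap[OF outer_sym[OF c0]]
    by (simp add: gap_def)
  moreover have "X [] = ?B"
    using c1 outer_carrier[OF c1] by (intro eq_matI) (auto simp: iterate_def mat_of_decomp_def)
  ultimately show ?thesis by (simp add: err_def past_def gap_def)
qed

end

subsection \<open>Convergence rates\<close>

lemma rank_spectrahedron_pos:
  assumes Y: "Y \<in> spectrahedron d"
  shows "1 \<le> real (vec_space.rank d Y)"
proof -
  note YD = spectrahedronD[OF Y]
  obtain u \<mu> where e: "eigenbasis d Y u \<mu>" using spectral_theorem[OF YD(2)] by blast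
  have "(\<Sum>j<d. \<mu> j) = 1" using eigenbasis_tr[OF e YD(1)] YD(4) by simp
  then have "{j \<in> {..<d}. \<mu> j \<noteq> 0} \<noteq> {}" by (force dest: sum.not_neutral_contains_not_neutral)
  then have "0 < card {j \<in> {..<d}. \<mu> j \<noteq> 0}" by (simp add: card_gt_0_iff)
  then show ?thesis using card_nonzero_eigenvalues_le_rank[OF e YD(1)] by simp
qed

text \<open>The step sizes satisfy \<open>1 - \<eta>\<^sub>t/2 = (t - 1)/(t + 8)\<close>, which leaves room for a noise of order
  \<open>b t / t\<close> as long as \<open>b\<close> decays no faster than \<open>t\<^sup>-\<^sup>2\<close>.\<close>

lemma rate_step:
  fixes t :: nat and C N b b' e e' s :: real
  assumes t: "t \<ge> 1" and b: "0 < b" "(real t / (real t + 1))\<^sup>2 * b \<le> b'"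
    and e: "e \<le> C * b" and s: "s \<le> N * b" and C: "0 < C" "11 * N \<le> C"
    and e': "e' \<le> (1 - eta t / 2) * e + eta t * s"
  shows "e' \<le> C * b'"
proof -
  define x where "x = real t"
  have x: "x \<ge> 1" using t by (simp add: x_def)
  have eta: "1 - eta t / 2 = (x - 1) / (x + 8)" "eta t = 18 / (x + 8)"
    using x by (simp_all add: eta_def x_def field_simps)
  have "(1 - eta t / 2) * e \<le> (x - 1) / (x + 8) * (C * b)"
    unfolding eta(1) using x e by (intro mult_left_mono) auto
  moreover have "eta t * s \<le> eta t * (N * b)" using s eta_pos[of t] by (intro mult_left_mono) auto
  \<comment> \<open>As 18/11 is below 7/4, the factor 11 keeps the noise within the share 7/4 that
    the comparison with the squared ratio tolerates.\<close>
  moreover have "18 * N * b \<le> 7/4 * C * b" using C b by (intro mult_right_mono) auto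
  then have "18 * N * b / (x + 8) \<le> 7/4 * C * b / (x + 8)" using x by (intro divide_right_mono) auto
  then have "eta t * (N * b) \<le> (7/4) / (x + 8) * (C * b)" by (simp add: eta(2))
  ultimately have "e' \<le> (x - 1) / (x + 8) * (C * b) + (7/4) / (x + 8) * (C * b)" using e' by linarith
  also have "\<dots> = (x + 3/4) / (x + 8) * (C * b)"
  proof -
    have "x + 3/4 = (x - 1) + 7/4" by simp
    then show ?thesis by (simp only: add_divide_distrib distrib_right)
  qed
  also have "\<dots> \<le> (x / (x + 1))\<^sup>2 * (C * b)"
  proof (rule mult_right_mono)
    have "1 * x \<le> x * x" using x by (intro mult_right_mono) auto
    moreover have "x\<^sup>2 * (x + 8) - (x + 3/4) * (x + 1)\<^sup>2 = 21/4 * (x * x) - 5/2 * x - 3/4"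
      by (simp add: power2_eq_square algebra_simps)
    ultimately have "(x + 3/4) * (x + 1)\<^sup>2 \<le> x\<^sup>2 * (x + 8)" using x by linarith
    then show "(x + 3/4) / (x + 8) \<le> (x / (x + 1))\<^sup>2"
      using x by (simp add: power_divide pos_divide_le_eq pos_le_divide_eq)
  qed (use C b in simp)
  also have "\<dots> = C * ((x / (x + 1))\<^sup>2 * b)" by simp
  also have "\<dots> \<le> C * b'" using b C by (intro mult_left_mono) (auto simp: x_def)
  finally show ?thesis .
qed

context rrcg
begin

text \<open>Induction on \<open>t\<close> for a candidate rate \<open>b\<close>. The noise
  assumption is granted the induction hypothesis, because the transport cost depends on the error.
  The factor 9 stems from \<open>eta t / 2 \<le> 9 / t\<close>.\<close>

lemma err_rate:
  assumes b: "\<And>t. t \<ge> 1 \<Longrightarrow> 0 < b t"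
      "\<And>t. t \<ge> 1 \<Longrightarrow> (real t / (real t + 1))\<^sup>2 * b t \<le> b (Suc t)" "\<beta> \<le> b 1"
    and C: "2 \<le> C" "11 * N \<le> C"
    and noise: "\<And>t. t \<ge> 1 \<Longrightarrow> err t \<le> C * b t \<Longrightarrow> \<exists>a k. 0 \<le> a * err t + k \<and>
      (\<forall>h\<in>set_pmf (past eta ev t). transportable d (dec h) Xs (a * gap (X h) + k)) \<and>
      9 * (\<beta> / t * (a * err t + k)) + \<xi> t \<le> N * b t"
    and "t \<ge> 1"
  shows "err t \<le> C * b t"
  using \<open>t \<ge> 1\<close>
proof (induction t rule: dec_induct)
  case base
  have "2 * \<beta> \<le> C * b 1" using C b(3) \<beta> by (intro mult_mono) auto
  then show ?case using err_1 by simp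
next
  case (step t)
  then have t: "t \<ge> 1" by simp
  obtain a k where ak: "0 \<le> a * err t + k"
    "\<And>h. h \<in> set_pmf (past eta ev t) \<Longrightarrow> transportable d (dec h) Xs (a * gap (X h) + k)"
    "9 * (\<beta> / t * (a * err t + k)) + \<xi> t \<le> N * b t"
    using noise[OF t step.IH] by blast
  define \<delta> where "\<delta> = a * err t + k"
  have "eta t * \<beta> / 2 * \<delta> \<le> 9 * (\<beta> / t) * \<delta>"
  proof (rule mult_right_mono)
    have "eta t * (\<beta> / 2) \<le> (18 / t) * (\<beta> / 2)"
      using t \<beta> unfolding eta_def by (intro mult_right_mono divide_left_mono mult_pos_pos) auto
    then show "eta t * \<beta> / 2 \<le> 9 * (\<beta> / t)" by simp
  qed (use ak(1) in \<open>simp add: \<delta>_def\<close>)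
  then have s: "eta t * \<beta> / 2 * \<delta> + \<xi> t \<le> N * b t" using ak(3) by (simp add: \<delta>_def)
  have "err (Suc t) \<le> (1 - eta t / 2) * err t + (eta t)\<^sup>2 * \<beta> / 2 * \<delta> + eta t * \<xi> t"
    unfolding \<delta>_def by (rule err_Suc[OF t ak(2)])
  also have "\<dots> = (1 - eta t / 2) * err t + eta t * (eta t * \<beta> / 2 * \<delta> + \<xi> t)"
    by (simp add: power2_eq_square algebra_simps)
  finally show ?case
    using rate_step[OF t b(1,2)[OF t] step.IH s] C by simp
qed

lemma past_iterate:
  assumes "h \<in> set_pmf (past eta ev t)"
  shows "unit_decomp d (dec h)" "X h \<in> spectrahedron d"
  using assms dec_invariant X_in_spectrahedron by (auto simp: past_def)

text \<open>Quadratic growth bounds \<open>sqrt \<alpha>\<close> times the distance by twice the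
  root of the gap, which AM-GM makes affine in the gap. The weight \<open>w\<close> is free; the
  rates choose the root of the claimed error bound.\<close>

lemma fro_norm_le_gap:
  assumes Y: "Y \<in> spectrahedron d" and w: "0 < w"
  shows "fro_norm (Y - Xs) \<le> (gap Y / w + w) / sqrt \<alpha>"
proof -
  have "(sqrt \<alpha> * fro_norm (Y - Xs))\<^sup>2 \<le> 4 * gap Y"
    using quadratic_growth[OF Y] \<alpha> by (simp add: power_mult_distrib)
  also have "\<dots> \<le> (gap Y / w + w)\<^sup>2"
  proof -
    have "(gap Y / w + w)\<^sup>2 - 4 * gap Y = (gap Y / w - w)\<^sup>2"
      using w by (simp add: power2_eq_square field_simps)
    then show ?thesis by (smt (verit) zero_le_power2)
  qed
  finally have "sqrt \<alpha> * fro_norm (Y - Xs) \<le> gap Y / w + w"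
    by (rule power2_le_imp_le) (use gap_nonneg[OF Y] w in simp)
  then show ?thesis using \<alpha> by (simp add: pos_le_divide_eq mult.commute)
qed

lemma err_rate_sublinear:
  assumes c: "0 < c" and \<xi>c: "\<And>t. t \<ge> 1 \<Longrightarrow> \<xi> t \<le> c * (\<beta> / t)"
    and C: "11 * (9 + c) \<le> C" and t: "t \<ge> 1"
  shows "err t \<le> C * (\<beta> / t)"
proof (rule err_rate[where N = "9 + c" and b = "\<lambda>t. \<beta> / real t"])
  fix t :: nat assume t: "t \<ge> 1"
  show "(real t / (real t + 1))\<^sup>2 * (\<beta> / real t) \<le> \<beta> / real (Suc t)"
  proof -
    have "(real t / (real t + 1))\<^sup>2 * (\<beta> / real t) = real t / (real t + 1) * (\<beta> / (real t + 1))"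
      using t by (simp add: power2_eq_square field_simps)
    also have "\<dots> \<le> 1 * (\<beta> / (real t + 1))" using \<beta> by (intro mult_right_mono) auto
    finally show ?thesis by (simp add: add.commute)
  qed
  show "\<exists>a k. 0 \<le> a * err t + k \<and>
      (\<forall>h\<in>set_pmf (past eta ev t). transportable d (dec h) Xs (a * gap (X h) + k)) \<and>
      9 * (\<beta> / real t * (a * err t + k)) + \<xi> t \<le> (9 + c) * (\<beta> / real t)"
    using \<xi>c[OF t] transportable_one[OF past_iterate(1) Xs]
    by (intro exI[of _ 0] exI[of _ 1]) (auto simp: algebra_simps add_divide_distrib)
qed (use \<beta> c C t in auto)

text \<open>The constant is written as a square because the transport cost grows like the root of
  the error: the noise is then linear in \<open>q\<close>, and a large \<open>q\<close> satisfies
  \<open>11 * N \<le> q\<^sup>2\<close>.\<close>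

lemma err_rate_eig_min:
  defines "b \<equiv> \<lambda>t. (\<beta> / (sqrt \<alpha> * eig_min_nonzero Xs * real t))\<^sup>2"
  assumes c: "0 < c" and \<xi>c: "\<And>t. t \<ge> 1 \<Longrightarrow> \<xi> t \<le> c * b t"
    and q: "2 \<le> q" "11 * (54 * q + c) \<le> q\<^sup>2" and t: "t \<ge> 1"
  shows "err t \<le> q\<^sup>2 * b t"
proof (rule err_rate[where N = "54 * q + c" and b = b])
  define l where "l = eig_min_nonzero Xs"
  have l: "0 < l" "l \<le> 1" using eig_min_nonzero_spectrahedron[OF Xs] by (auto simp: l_def)
  have b: "b t = (\<beta> / (sqrt \<alpha> * l * t))\<^sup>2" for t by (simp add: b_def l_def)
  show "0 < b t" if "t \<ge> 1" for t using that \<alpha> \<beta> l by (simp add: b)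
  show "\<beta> \<le> b 1"
  proof -
    have "\<alpha> * l\<^sup>2 \<le> \<beta> * 1" using \<alpha> \<alpha>\<beta> l by (intro mult_mono) (auto simp: power_le_one)
    then have "\<beta> * (\<alpha> * l\<^sup>2) \<le> \<beta> * \<beta>" using \<beta> by (intro mult_left_mono) auto
    then show ?thesis using \<alpha> l by (simp add: b power_divide power_mult_distrib power2_eq_square field_simps)
  qed
  fix t :: nat assume t: "t \<ge> 1"
  show "(real t / (real t + 1))\<^sup>2 * b t \<le> b (Suc t)"
    using t unfolding b power_mult_distrib[symmetric] by (simp add: ac_simps)
  \<comment> \<open>\<open>s\<close> is the root of \<open>b t\<close>, and \<open>w\<close> is that
    of the claimed bound \<open>q\<^sup>2 * b t\<close>.\<close>
  define s where "s = \<beta> / (sqrt \<alpha> * l * t)"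
  define w where "w = q * s"
  have s: "0 < s" using t \<alpha> \<beta> l by (simp add: s_def)
  have w: "0 < w" using s q by (simp add: w_def)
  assume IH: "err t \<le> q\<^sup>2 * b t"
  let ?a = "3 / (l * sqrt \<alpha> * w)" and ?k = "3 * w / (l * sqrt \<alpha>)"
  have "transportable d (dec h) Xs (?a * gap (X h) + ?k)" if h: "h \<in> set_pmf (past eta ev t)" for h
  proof -
    note Xh = past_iterate[OF h]
    let ?\<Delta> = "(gap (X h) / w + w) / sqrt \<alpha>"
    have "0 < ?\<Delta>" using gap_nonneg[OF Xh(2)] w \<alpha> by (simp add: add_nonneg_pos)
    moreover have "fro_norm (mat_of_decomp d (dec h) - Xs) \<le> ?\<Delta>"
      using fro_norm_le_gap[OF Xh(2) w] by (simp add: iterate_def)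
    ultimately have "transportable d (dec h) Xs (3 * (?\<Delta> / eig_min_nonzero Xs))"
      by (rule transportable_eig_min[OF Xh(1) Xs])
    also have "3 * (?\<Delta> / eig_min_nonzero Xs) = ?a * gap (X h) + ?k"
      by (simp add: l_def add_divide_distrib mult.commute)
    finally show ?thesis .
  qed
  moreover have "0 \<le> ?a * err t + ?k" using err_nonneg w l \<alpha> by simp
  moreover have "9 * (\<beta> / t * (?a * err t + ?k)) + \<xi> t \<le> (54 * q + c) * b t"
  proof -
    have "?a * err t + ?k \<le> ?a * (q\<^sup>2 * b t) + ?k"
      using IH w l \<alpha> by (intro add_right_mono mult_left_mono) auto
    also have "q\<^sup>2 * b t = w * w" by (simp add: b w_def s_def power2_eq_square)
    \<comment> \<open>At an error of \<open>w * w\<close> both halves of AM-GM contribute 3, which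
      with the factor 9 explains the 54.\<close>
    also have "?a * (w * w) + ?k = 6 * (w / (l * sqrt \<alpha>))" using w by simp
    finally have "\<beta> / t * (?a * err t + ?k) \<le> \<beta> / t * (6 * (w / (l * sqrt \<alpha>)))"
      using \<beta> by (intro mult_left_mono) auto
    also have "\<dots> = 6 * w * s" by (simp add: s_def mult_ac)
    also have "\<dots> = 6 * q * b t" by (simp add: w_def b s_def[symmetric] power2_eq_square)
    finally have "\<beta> / t * (?a * err t + ?k) \<le> 6 * q * b t" .
    moreover have "(54 * q + c) * b t = 9 * (6 * q * b t) + c * b t" by (simp add: algebra_simps)
    ultimately show ?thesis using \<xi>c[OF t] by linarith
  qed
  ultimately show "\<exists>a k. 0 \<le> a * err t + k \<and>
      (\<forall>h\<in>set_pmf (past eta ev t). transportable d (dec h) Xs (a * gap (X h) + k)) \<and>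
      9 * (\<beta> / real t * (a * err t + k)) + \<xi> t \<le> (54 * q + c) * b t"
    by blast
qed (use q t power_mono[of 2 q 2] in auto)

text \<open>In terms of the cube root \<open>s\<close> of \<open>Q / t\<close>, the rate is
  \<open>s ^ 4\<close> and \<open>\<beta> / t\<close> is \<open>s ^ 3 * \<kappa> / \<rho>\<close>,
  so a transport cost of order \<open>\<rho> * s / \<kappa>\<close> is wanted.\<close>

lemma err_rate_rank:
  defines "b \<equiv> \<lambda>t. (\<beta> * sqrt (real (vec_space.rank d Xs)) / (\<alpha> powr (1/4) * real t)) powr (4/3)"
  assumes c: "0 < c" and \<xi>c: "\<And>t. t \<ge> 1 \<Longrightarrow> \<xi> t \<le> c * b t"
    and q: "2 \<le> q" "11 * (72 * q + c) \<le> q\<^sup>2" and t: "t \<ge> 1"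
  shows "err t \<le> q\<^sup>2 * b t"
proof (rule err_rate[where N = "72 * q + c" and b = b])
  define r where "r = real (vec_space.rank d Xs)"
  define \<kappa> where "\<kappa> = \<alpha> powr (1/4)"
  define \<rho> where "\<rho> = sqrt r"
  define Q where "Q = \<beta> * \<rho> / \<kappa>"
  have r: "1 \<le> r" unfolding r_def by (rule rank_spectrahedron_pos[OF Xs])
  have sr: "1 \<le> \<rho>" "\<rho> * \<rho> = r" using r by (auto simp: \<rho>_def)
  have \<kappa>: "0 < \<kappa>" "\<kappa>\<^sup>2 = sqrt \<alpha>"
    using \<alpha> by (simp_all add: \<kappa>_def power2_eq_square powr_half_sqrt flip: powr_add)
  have Q: "0 < Q" using \<beta> \<kappa> sr by (simp add: Q_def)
  have b: "b t = (Q / t) powr (4/3)" for t by (simp add: b_def Q_def \<rho>_def r_def \<kappa>_def)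
  show "0 < b t" if "t \<ge> 1" for t using that Q by (simp add: b)
  show "\<beta> \<le> b 1"
  proof -
    \<comment> \<open>From \<open>\<alpha> \<le> \<beta>\<close> and \<open>\<rho> \<ge> 1\<close>
      it follows that \<open>Q\<close> is at least \<open>\<beta> powr (3/4)\<close>; the exponent
      4/3 of the rate returns \<open>\<beta>\<close>.\<close>
    have "\<kappa> \<le> \<beta> powr (1/4)" unfolding \<kappa>_def using \<alpha> \<alpha>\<beta> by (intro powr_mono2) auto
    then have "\<beta> powr (3/4) * \<kappa> \<le> \<beta> powr (3/4) * \<beta> powr (1/4)" by (intro mult_left_mono) auto
    also have "\<dots> = \<beta>" using \<beta> by (simp flip: powr_add)
    also have "\<dots> \<le> \<beta> * \<rho>" using \<beta> sr by simp
    finally have "\<beta> powr (3/4) \<le> Q" using \<kappa> by (simp add: Q_def field_simps)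
    then have "(\<beta> powr (3/4)) powr (4/3) \<le> Q powr (4/3)" by (intro powr_mono2) auto
    then show ?thesis using \<beta> by (simp add: b powr_powr)
  qed
  fix t :: nat assume t: "t \<ge> 1"
  show "(real t / (real t + 1))\<^sup>2 * b t \<le> b (Suc t)"
  proof -
    let ?\<rho> = "real t / (real t + 1)"
    have \<rho>: "0 < ?\<rho>" "?\<rho> \<le> 1" using t by auto
    have "?\<rho>\<^sup>2 = ?\<rho> powr 2" using \<rho> by (simp add: powr_numeral)
    also have "\<dots> \<le> ?\<rho> powr (4/3)" using \<rho> by (intro powr_mono') auto
    finally have "?\<rho>\<^sup>2 * b t \<le> ?\<rho> powr (4/3) * b t" by (intro mult_right_mono) (auto simp: b)
    also have "\<dots> = (?\<rho> * (Q / t)) powr (4/3)" using \<rho> Q by (simp only: b powr_mult)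
    also have "?\<rho> * (Q / t) = Q / Suc t" using t by (simp add: add.commute)
    finally show ?thesis by (simp only: b)
  qed
  define s where "s = (Q / t) powr (1/3)"
  have s: "0 < s" using Q t by (simp add: s_def)
  have s3: "s ^ 3 = Q / t" using Q t by (simp add: s_def powr_power)
  have s4: "b t = s ^ 4" using Q t by (simp add: s_def b powr_power)
  have \<beta>t: "\<beta> / t = s ^ 3 * \<kappa> / \<rho>" using \<kappa> sr by (simp add: s3 Q_def)
  assume IH: "err t \<le> q\<^sup>2 * b t"
  show "\<exists>a k. 0 \<le> a * err t + k \<and>
      (\<forall>h\<in>set_pmf (past eta ev t). transportable d (dec h) Xs (a * gap (X h) + k)) \<and>
      9 * (\<beta> / real t * (a * err t + k)) + \<xi> t \<le> (72 * q + c) * b t"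
  \<comment> \<open>In the first case the wanted order is at least 1, so the trivial transport cost
    1 is good enough.\<close>
  proof (cases "\<kappa> \<le> \<rho> * s")
    case True
    have "\<beta> / t \<le> s ^ 3 * (\<rho> * s) / \<rho>"
      unfolding \<beta>t using True s sr by (intro divide_right_mono mult_left_mono) auto
    also have "\<dots> = b t" using sr by (simp add: s4 eval_nat_numeral)
    finally have "9 * (\<beta> / t) + \<xi> t \<le> 9 * b t + c * b t" using \<xi>c[OF t] by simp
    also have "\<dots> \<le> (72 * q) * b t + c * b t"
      using q s by (intro add_right_mono mult_right_mono) (auto simp: s4)
    finally have "9 * (\<beta> / t) + \<xi> t \<le> (72 * q + c) * b t" by (simp add: algebra_simps)
    then show ?thesis
      using transportable_one[OF past_iterate(1) Xs] by (intro exI[of _ 0] exI[of _ 1]) auto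
  next
    case False
    define w where "w = q * s\<^sup>2"
    \<comment> \<open>The distance being of order \<open>s\<^sup>2 / \<kappa>\<^sup>2\<close>, this
      threshold balances \<open>\<Delta> / \<tau>\<close> with \<open>r * \<tau>\<close>: both are
      of order \<open>\<rho> * s / \<kappa>\<close>.\<close>
    define \<tau> where "\<tau> = s / (\<kappa> * \<rho>)"
    have w: "0 < w" using s q by (simp add: w_def)
    have \<tau>: "0 < \<tau>" using s \<kappa> sr by (simp add: \<tau>_def)
    define m where "m = 1 / \<tau> + 2 * \<rho>"
    have m_mult: "D / \<tau> + 2 * (r * \<tau> + \<rho> * D) = m * D + 2 * (r * \<tau>)" for D
      by (simp add: m_def algebra_simps)
    have m: "0 < m" using \<tau> sr by (simp add: m_def add_pos_pos)
    have rt: "r * \<tau> = \<rho> * s / \<kappa>"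
      unfolding \<tau>_def sr(2)[symmetric] using sr(1) by simp
    let ?a = "m / (w * \<kappa>\<^sup>2)" and ?k = "m * w / \<kappa>\<^sup>2 + 2 * (r * \<tau>)"
    have "transportable d (dec h) Xs (?a * gap (X h) + ?k)" if h: "h \<in> set_pmf (past eta ev t)" for h
    proof -
      note Xh = past_iterate[OF h]
      let ?\<Delta> = "(gap (X h) / w + w) / sqrt \<alpha>"
      have "0 < ?\<Delta>" using gap_nonneg[OF Xh(2)] w \<alpha> by (simp add: add_nonneg_pos)
      moreover have "fro_norm (mat_of_decomp d (dec h) - Xs) \<le> ?\<Delta>"
        using fro_norm_le_gap[OF Xh(2) w] by (simp add: iterate_def)
      ultimately have "transportable d (dec h) Xs (?\<Delta> / \<tau> + 2 * (r * \<tau> + \<rho> * ?\<Delta>))"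
        by (rule transportable_rank[OF Xh(1) Xs \<tau> _ _ r_def, folded \<rho>_def])
      also have "?\<Delta> / \<tau> + 2 * (r * \<tau> + \<rho> * ?\<Delta>) = m * ?\<Delta> + 2 * (r * \<tau>)"
        using m_mult[of ?\<Delta>] .
      also have "\<dots> = ?a * gap (X h) + ?k"
        unfolding \<kappa>(2) using w \<alpha> by (simp add: field_simps)
      finally show ?thesis .
    qed
    moreover have "0 \<le> ?a * err t + ?k"
      using err_nonneg[of t] w \<kappa>(1) m r \<tau> by (intro add_nonneg_nonneg mult_nonneg_nonneg) auto
    moreover have "9 * (\<beta> / t * (?a * err t + ?k)) + \<xi> t \<le> (72 * q + c) * b t"
    proof -
      have "?a * err t + ?k \<le> ?a * (q\<^sup>2 * b t) + ?k"
        using IH w m by (intro add_right_mono mult_left_mono) auto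
      also have "q\<^sup>2 * b t = w * w" by (simp add: s4 w_def eval_nat_numeral)
      also have "?a * (w * w) + ?k = 2 * (m * w / \<kappa>\<^sup>2) + 2 * (r * \<tau>)" using w by simp
      also have "m * w / \<kappa>\<^sup>2 \<le> 3 * q * (\<rho> * s / \<kappa>)"
      proof -
        have "\<rho> * s \<le> \<kappa>" using False by simp
        moreover have "1 * s \<le> \<rho> * s" using sr s by (intro mult_right_mono) auto
        \<comment> \<open>Hence the summand \<open>2 * \<rho>\<close> of \<open>m\<close> is
          dominated by \<open>2 / \<tau>\<close>, and \<open>m\<close> by
          \<open>3 / \<tau>\<close>.\<close>
        ultimately have "s \<le> \<kappa>" by simp
        then have "2 * \<rho> * s \<le> 2 * \<rho> * \<kappa>" using sr s by (intro mult_left_mono) auto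
        then have "2 * \<rho> \<le> 2 * (\<kappa> * \<rho> / s)" using s by (simp add: field_simps)
        then have "m \<le> 3 * (\<kappa> * \<rho> / s)" by (simp add: m_def \<tau>_def)
        then have "m * w / \<kappa>\<^sup>2 \<le> 3 * (\<kappa> * \<rho> / s) * w / \<kappa>\<^sup>2"
          using w by (intro divide_right_mono mult_right_mono) auto
        also have "\<dots> = 3 * q * (\<rho> * s / \<kappa>)"
          using s \<kappa>(1) by (simp add: w_def power2_eq_square field_simps)
        finally show ?thesis .
      qed
      also have "2 * (3 * q * (\<rho> * s / \<kappa>)) + 2 * (r * \<tau>) = (6 * q + 2) * (\<rho> * s / \<kappa>)"
        unfolding rt by (simp add: algebra_simps)
      also have "\<dots> \<le> (8 * q) * (\<rho> * s / \<kappa>)" using q sr s \<kappa> by (intro mult_right_mono) auto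
      finally have "\<beta> / t * (?a * err t + ?k) \<le> \<beta> / t * ((8 * q) * (\<rho> * s / \<kappa>))"
        using \<beta> by (intro mult_left_mono) auto
      also have "\<dots> = 8 * q * b t"
        unfolding \<beta>t s4 using sr(1) \<kappa>(1) by (simp add: eval_nat_numeral)
      finally have "\<beta> / t * (?a * err t + ?k) \<le> 8 * q * b t" .
      moreover have "(72 * q + c) * b t = 9 * (8 * q * b t) + c * b t" by (simp add: algebra_simps)
      ultimately show ?thesis using \<xi>c[OF t] by linarith
    qed
    ultimately show ?thesis by blast
  qed
qed (use q t power_mono[of 2 q 2] in auto)

lemma err_le_rate_bound:
  assumes c: "0 < c" and \<xi>c: "\<And>t. t \<ge> 1 \<Longrightarrow> \<xi> t \<le> c * rate_bound d \<alpha> \<beta> Xs t" and t: "t \<ge> 1"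
  shows "err t \<le> (792 + 11 * c)\<^sup>2 * rate_bound d \<alpha> \<beta> Xs t"
proof -
  \<comment> \<open>72 is the largest of the three noise factors and 792 is 11 times 72, so
    \<open>q\<^sup>2 = (792 + 11 * c) * q\<close> covers \<open>11 * (72 * q + c)\<close> and with
    it the conditions of the other two rates.\<close>
  define q where "q = 792 + 11 * c"
  let ?b1 = "\<lambda>t. \<beta> / real t"
  let ?b2 = "\<lambda>t. (\<beta> * sqrt (real (vec_space.rank d Xs)) / (\<alpha> powr (1/4) * real t)) powr (4/3)"
  let ?b3 = "\<lambda>t. (\<beta> / (sqrt \<alpha> * eig_min_nonzero Xs * real t))\<^sup>2"
  have rb: "rate_bound d \<alpha> \<beta> Xs t \<le> ?b1 t" "rate_bound d \<alpha> \<beta> Xs t \<le> ?b2 t" "rate_bound d \<alpha> \<beta> Xs t \<le> ?b3 t" for t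
    by (simp_all add: rate_bound_def)
  have \<xi>b: "\<xi> t \<le> c * ?b1 t" "\<xi> t \<le> c * ?b2 t" "\<xi> t \<le> c * ?b3 t" if "t \<ge> 1" for t
    using \<xi>c[OF that] mult_left_mono[OF rb(1)[of t], of c] mult_left_mono[OF rb(2)[of t], of c]
      mult_left_mono[OF rb(3)[of t], of c] c by (auto intro: order_trans)
  have q: "2 \<le> q" using c by (simp add: q_def)
  have "q\<^sup>2 = 792 * q + 11 * c * q" by (simp add: q_def power2_eq_square algebra_simps)
  moreover have "11 * c * 1 \<le> 11 * c * q" using c q by (intro mult_left_mono) auto
  ultimately have q2: "11 * (72 * q + c) \<le> q\<^sup>2" by simp
  then have q3: "11 * (54 * q + c) \<le> q\<^sup>2" and q1: "11 * (9 + c) \<le> q\<^sup>2" using q by simp_all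
  have "rate_bound d \<alpha> \<beta> Xs t \<in> {?b1 t, ?b2 t, ?b3 t}"
    unfolding rate_bound_def by (rule Min_in) auto
  then show ?thesis
    unfolding q_def[symmetric]
    using err_rate_sublinear[OF c \<xi>b(1) q1 t] err_rate_rank[OF c \<xi>b(2) q q2 t]
      err_rate_eig_min[OF c \<xi>b(3) q q3 t] by auto
qed

end

theorem theorem1:
  shows "\<forall>c>0. \<exists>C>0. \<forall>(d::nat) (f::real mat \<Rightarrow> real) (g::real mat \<Rightarrow> real mat)
      (\<alpha>::real) (\<beta>::real) (Xs::real mat) (\<xi>::nat \<Rightarrow> real) (x\<^sub>0::real vec) (ev::history \<Rightarrow> real vec).
    let \<eta> = (\<lambda>t. 18 / (real t + 8)); B = rate_bound d \<alpha> \<beta> Xs in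
    0 < \<alpha> \<longrightarrow> \<alpha> \<le> \<beta> \<longrightarrow>
    is_gradient d f g \<longrightarrow> strongly_convex d \<alpha> f g \<longrightarrow> smooth d \<beta> f g \<longrightarrow>
    is_arg_min f (\<lambda>X. X \<in> spectrahedron d) Xs \<longrightarrow>
    \<xi> 0 = \<beta> \<longrightarrow> (\<forall>t\<ge>1. 0 < \<xi> t \<and> \<xi> t \<le> c * B t) \<longrightarrow>
    RRCG_run d g \<beta> \<eta> \<xi> x\<^sub>0 ev \<longrightarrow>
    (\<forall>t\<ge>1. \<forall>h \<in> set_pmf (past \<eta> ev t). iterate d \<eta> ev h \<in> spectrahedron d) \<and>
    (\<forall>t\<ge>1. measure_pmf.expectation (past \<eta> ev t) (\<lambda>h. f (iterate d \<eta> ev h) - f Xs) \<le> C * B t)"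
  (is "\<forall>c>0. \<exists>C>0. ?P c C")
proof (intro allI impI)
  fix c :: real assume c: "0 < c"
  have eta: "(\<lambda>t. 18 / (real t + 8)) = eta" by (simp add: fun_eq_iff eta_def)
  show "\<exists>C>0. ?P c C"
    unfolding eta Let_def
  proof (rule exI[of _ "(792 + 11 * c)\<^sup>2"], intro conjI allI impI)
    show "0 < (792 + 11 * c)\<^sup>2" using c by simp
  next
    fix d f g \<alpha> \<beta> Xs \<xi> x\<^sub>0 ev t h
    assume a: "0 < \<alpha>" "\<alpha> \<le> \<beta>" "is_gradient d f g" "strongly_convex d \<alpha> f g" "smooth d \<beta> f g"
      "is_arg_min f (\<lambda>X. X \<in> spectrahedron d) Xs" "\<xi> 0 = \<beta>"
      "\<forall>t\<ge>1. 0 < \<xi> t \<and> \<xi> t \<le> c * rate_bound d \<alpha> \<beta> Xs t" "RRCG_run d g \<beta> eta \<xi> x\<^sub>0 ev"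
    interpret rrcg d f g \<alpha> \<beta> Xs \<xi> x\<^sub>0 ev by unfold_locales (use a in auto)
    show "\<forall>h\<in>set_pmf (past eta ev t). iterate d eta ev h \<in> spectrahedron d"
      using past_iterate(2) by blast
    show "measure_pmf.expectation (past eta ev t) (\<lambda>h. f (iterate d eta ev h) - f Xs)
        \<le> (792 + 11 * c)\<^sup>2 * rate_bound d \<alpha> \<beta> Xs t" if "t \<ge> 1"
      using err_le_rate_bound[OF c _ that] a(8) by (simp add: err_def gap_def)
  qed
qed

end
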